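(* Let $1\leq p<\infty$. Then $$H^p=\bigcap_{g\in \mathrm{BMOA}}[T_g,H^p].$$
   Context: $\mathbb D$ is the open unit disk and $\mathrm{Hol}(\mathbb D)$ is the space of analytic functions on $\mathbb D$. For $1\le p<\infty$, $H^p$ is the Hardy space of $f\in\mathrm{Hol}(\mathbb D)$ with $\|f\|_p=\sup_{0\le r<1}\left(\int_0^{2\pi}|f(re^{it})|^p\frac{dt}{2\pi}\right)^{1/p}<\infty$. $\mathrm{BMOA}$ is the space of $g\in H^2$ with $\sup_{a\in\mathbb D}\|g\circ\phi_a-g(a)\|_2<\infty$, where $\phi_a(z)=\frac{a-z}{1-\overline a z}$. For $f,g\in\mathrm{Hol}(\mathbb D)$, the generalized Volterra operator is $T_g(f)(z)=\int_0^z f(\zeta)g'(\zeta)\,d\zeta$, $z\in\mathbb D$. The optimal domain is $[T_g,H^p]=\{f\in\mathrm{Hol}(\mathbb D): T_g(f)\in H^p\}$; in particular $[T_g,H^p]=\mathrm{Hol}(\mathbb D)$ when $g$ is constant. *)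

theory Defs
  imports "HOL-Complex_Analysis.Complex_Analysis"
begin

text \<open>
  Functions on the open unit disk are represented by total functions on the complex plane;
  membership in the spaces below only depends on the values inside the disk.
\<close>

abbreviation unit_disk :: "complex set" where
  "unit_disk \<equiv> ball 0 1"

definition Hol :: "(complex \<Rightarrow> complex) set" where
  "Hol = {f. f holomorphic_on unit_disk}"

text \<open>
  The norm takes values in \<open>[0,\<infinity>]\<close>. It is only used for functions holomorphic on the disk, so the
  integrand is continuous and the gauge integral is the ordinary one.
\<close>

definition hardy_norm :: "real \<Rightarrow> (complex \<Rightarrow> complex) \<Rightarrow> ennreal" where
  "hardy_norm p f =
     (SUP r\<in>{0..<1::real}.
        ennreal ((integral {0..2*pi} (\<lambda>t. norm (f (of_real r * exp (\<i> * of_real t))) powr p / (2*pi)))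
                 powr (1/p)))"

definition hardy_space :: "real \<Rightarrow> (complex \<Rightarrow> complex) set" where
  "hardy_space p = {f \<in> Hol. hardy_norm p f < \<infinity>}"

definition disk_aut :: "complex \<Rightarrow> complex \<Rightarrow> complex" where
  "disk_aut a z = (a - z) / (1 - cnj a * z)"

definition BMOA :: "(complex \<Rightarrow> complex) set" where
  "BMOA = {g \<in> hardy_space 2.
     (SUP a\<in>unit_disk. hardy_norm 2 (\<lambda>z. g (disk_aut a z) - g a)) < \<infinity>}"

definition volterra :: "(complex \<Rightarrow> complex) \<Rightarrow> (complex \<Rightarrow> complex) \<Rightarrow> complex \<Rightarrow> complex" where
  "volterra g f z = contour_integral (linepath 0 z) (\<lambda>w. f w * deriv g w)"

definition optimal_domain :: "(complex \<Rightarrow> complex) \<Rightarrow> real \<Rightarrow> (complex \<Rightarrow> complex) set" where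
  "optimal_domain g p = {f \<in> Hol. volterra g f \<in> hardy_space p}"

end

theory Submission
  imports Defs
begin

text \<open>
  For \<open>g\<close> in BMOA the difference \<open>\<phi> = |g|\<^sup>2 - P[|g|\<^sup>2]\<close> of \<open>|g|\<^sup>2\<close> and its harmonic majorant is bounded and has
  Laplacian \<open>4 |g'|\<^sup>2\<close>. Hence \<open>e\<^sup>\<phi> (1 + |f|\<^sup>2)\<^sup>q\<close>, with \<open>q = p/2\<close>, is subharmonic with Laplacian at least a
  constant times \<open>|f|\<^sup>p |g'|\<^sup>2\<close>, which replaces the Carleson embedding. For \<open>F = T\<^sub>g f\<close>, a combination of such
  functions minus \<open>(1 + |F|\<^sup>2)\<^sup>q\<close> (for \<open>p > 2\<close>) or \<open>(1 + |f|\<^sup>2 + |F|\<^sup>2)\<^sup>q\<close> (for \<open>p \<le> 2\<close>) is subharmonic, and its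
  sub-mean value property at 0 bounds the means of \<open>|F|\<^sup>p\<close> by those of \<open>|f|\<^sup>p\<close>. To avoid boundary values, all
  this is done on disks of radius \<open>R < 1\<close> with bounds independent of \<open>R\<close>.

  Conversely, if the means of \<open>|f|\<^sup>p\<close> are unbounded, choose sparse radii \<open>r k\<close> along which they grow fast and let
  \<open>g z = \<Sum>k. (1/2)^k * z^(n k)\<close> with \<open>n k\<close> comparable to \<open>1 / (1 - r k)\<close>. Then \<open>(1 - |z|) |g' z|\<close> is at least a
  constant times \<open>(1/2)^k\<close> on \<open>|z| = r k\<close>, whereas \<open>F = T\<^sub>g f\<close> in the Hardy space would bound the means of
  \<open>((1 - |z|) |F'|)\<^sup>p = ((1 - |z|) |f g'|)\<^sup>p\<close>.
\<close>

section \<open>Circle means, Hardy spaces and BMOA\<close>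

text \<open>The value type covers both the real means of \<open>|f|^p\<close> and the complex circle
  integrals of Cauchy type.\<close>

definition cmean :: "real \<Rightarrow> (complex \<Rightarrow> 'a::{real_normed_field,banach}) \<Rightarrow> 'a" where
  "cmean r u = integral {0..2*pi} (\<lambda>t. u (of_real r * cis t)) / of_real (2*pi)"

lemma cmean_cong:
  assumes "\<And>z. norm z = \<bar>r\<bar> \<Longrightarrow> u z = v z"
  shows "cmean r u = cmean r v"
  unfolding cmean_def using assms by (simp add: norm_mult)

lemma circle_integrable:
  fixes u :: "complex \<Rightarrow> 'a::banach"
  assumes "continuous_on (sphere 0 \<bar>r\<bar>) u"
  shows "(\<lambda>t. u (of_real r * cis t)) integrable_on {a..b}"
proof (rule integrable_continuous_real)
  show "continuous_on {a..b} (\<lambda>t. u (of_real r * cis t))"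
    by (rule continuous_on_compose2[OF assms, of _ "\<lambda>t. of_real r * cis t"])
       (auto intro!: continuous_intros simp: norm_mult)
qed

lemma cmean_const [simp]: "cmean r (\<lambda>_. c) = c"
  by (simp add: cmean_def scaleR_conv_of_real)

lemma cmean_add:
  assumes "continuous_on (sphere 0 \<bar>r\<bar>) u" "continuous_on (sphere 0 \<bar>r\<bar>) v"
  shows "cmean r (\<lambda>z. u z + v z) = cmean r u + cmean r v"
  using circle_integrable[OF assms(1)] circle_integrable[OF assms(2)]
  by (simp add: cmean_def integral_add add_divide_distrib)

lemma cmean_cmult: "cmean r (\<lambda>z. c * u z) = c * cmean r u"
  by (simp add: cmean_def)

lemma cmean_mono:
  fixes u v :: "complex \<Rightarrow> real"
  assumes "continuous_on (sphere 0 \<bar>r\<bar>) u" "continuous_on (sphere 0 \<bar>r\<bar>) v"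
    and "\<And>z. norm z = \<bar>r\<bar> \<Longrightarrow> u z \<le> v z"
  shows "cmean r u \<le> cmean r v"
  unfolding cmean_def
  using assms by (auto intro!: divide_right_mono integral_le circle_integrable simp: norm_mult)

lemma cmean_nonneg:
  fixes u :: "complex \<Rightarrow> real"
  assumes "continuous_on (sphere 0 \<bar>r\<bar>) u" "\<And>z. norm z = \<bar>r\<bar> \<Longrightarrow> 0 \<le> u z"
  shows "0 \<le> cmean r u"
  using cmean_mono[of r "\<lambda>_. 0" u] assms by simp

lemma cmean_Re:
  assumes "continuous_on (sphere 0 \<bar>r\<bar>) u"
  shows "cmean r (\<lambda>z. Re (u z)) = Re (cmean r u)"
proof -
  have "integral {0..2*pi} (Re \<circ> (\<lambda>t. u (of_real r * cis t)))
      = Re (integral {0..2*pi} (\<lambda>t. u (of_real r * cis t)))"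
    by (rule integral_linear[OF circle_integrable[OF assms] bounded_linear_Re])
  moreover have "Re (x / (2 * complex_of_real pi)) = Re x / (2*pi)" for x
    using Re_divide_of_real[of x "2*pi"] by simp
  ultimately show ?thesis
    by (simp add: cmean_def o_def)
qed

lemma hardy_integral_eq_cmean:
  "integral {0..2*pi} (\<lambda>t. norm (f (of_real r * exp (\<i> * of_real t))) powr p / (2*pi))
     = cmean r (\<lambda>z. norm (f z) powr p)"
  by (simp add: cmean_def cis_conv_exp)

lemma hardy_norm_eq:
  "hardy_norm p f = (SUP r\<in>{0..<1}. ennreal (cmean r (\<lambda>z. norm (f z) powr p) powr (1/p)))"
  unfolding hardy_norm_def hardy_integral_eq_cmean ..

lemma continuous_on_norm_powr:
  fixes f :: "complex \<Rightarrow> complex"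
  assumes "continuous_on S f" "0 < p"
  shows "continuous_on S (\<lambda>z. norm (f z) powr p)"
  using assms by (intro continuous_on_powr' continuous_intros) auto

lemma hardy_norm_finite_iff:
  assumes "0 < p" "continuous_on unit_disk f"
  shows "hardy_norm p f < \<infinity> \<longleftrightarrow> (\<exists>C. \<forall>r\<in>{0..<1}. cmean r (\<lambda>z. norm (f z) powr p) \<le> C)"
    (is "_ \<longleftrightarrow> (\<exists>C. \<forall>r\<in>{0..<1}. ?m r \<le> C)")
proof -
  have nonneg: "0 \<le> ?m r" if "r \<in> {0..<1}" for r
    using that by (intro cmean_nonneg continuous_on_norm_powr continuous_on_subset[OF assms(2)] assms) auto
  note eq = hardy_norm_eq[of p f]
  show ?thesis
  proof
    assume "hardy_norm p f < \<infinity>"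
    then obtain c where c: "hardy_norm p f = ennreal c" "0 \<le> c"
      by (cases "hardy_norm p f") auto
    have "?m r \<le> c powr p" if r: "r \<in> {0..<1}" for r
    proof -
      have "ennreal (?m r powr (1/p)) \<le> ennreal c"
        unfolding c(1)[symmetric] eq using r by (rule SUP_upper)
      then have "?m r powr (1/p) \<le> c" using c by simp
      then have "(?m r powr (1/p)) powr p \<le> c powr p"
        using assms by (intro powr_mono2) auto
      then show ?thesis using assms nonneg[OF r] by (simp add: powr_powr)
    qed
    then show "\<exists>C. \<forall>r\<in>{0..<1}. ?m r \<le> C" by blast
  next
    assume "\<exists>C. \<forall>r\<in>{0..<1}. ?m r \<le> C"
    then obtain C where "\<And>r. r \<in> {0..<1} \<Longrightarrow> ?m r \<le> C" by blast
    then have "hardy_norm p f \<le> ennreal (C powr (1/p))"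
      unfolding eq using assms nonneg by (intro SUP_least ennreal_leI powr_mono2) auto
    then show "hardy_norm p f < \<infinity>"
      using ennreal_less_top le_less_trans by (metis infinity_ennreal_def)
  qed
qed

text \<open>The working form of membership, free of the root and of extended reals.\<close>

lemma hardy_space_iff:
  assumes "0 < p"
  shows "f \<in> hardy_space p \<longleftrightarrow> f holomorphic_on unit_disk \<and>
    (\<exists>C. \<forall>r\<in>{0..<1}. cmean r (\<lambda>z. norm (f z) powr p) \<le> C)"
  using hardy_norm_finite_iff[OF assms] holomorphic_on_imp_continuous_on
  by (auto simp: hardy_space_def Hol_def)

section \<open>Disk automorphisms and the BMOA condition\<close>

lemma disk_aut_denom_nonzero:
  assumes "norm a < 1" "norm z \<le> 1"
  shows "1 - cnj a * z \<noteq> 0"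
proof
  assume "1 - cnj a * z = 0"
  then have "norm (cnj a * z) = 1" by (metis eq_iff_diff_eq_0 norm_one)
  then have "norm a * norm z = 1" by (simp add: norm_mult)
  moreover have "norm a * norm z \<le> norm a * 1" using assms by (intro mult_left_mono) auto
  ultimately show False using assms by simp
qed

lemma disk_aut_holomorphic:
  assumes "norm a < 1"
  shows "disk_aut a holomorphic_on cball 0 1"
  unfolding disk_aut_def using disk_aut_denom_nonzero[OF assms]
  by (intro holomorphic_intros) auto

text \<open>The gap between the squared moduli of denominator and numerator factors as
  \<open>(1 - |a|^2) * (1 - |z|^2)\<close>, which is positive.\<close>

lemma norm_disk_aut:
  assumes "norm a < 1" "norm z < 1"
  shows "norm (disk_aut a z) < 1"
proof -
  have "(norm (1 - cnj a * z))\<^sup>2 - (norm (a - z))\<^sup>2 = (1 - (norm a)\<^sup>2) * (1 - (norm z)\<^sup>2)"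
    unfolding cmod_power2 by (simp add: power2_eq_square algebra_simps)
  also have "\<dots> > 0" using assms by (auto intro!: mult_pos_pos simp: power_less_one_iff abs_square_less_1)
  finally have "norm (a - z) < norm (1 - cnj a * z)"
    by (simp add: power2_less_imp_less)
  then show ?thesis
    using disk_aut_denom_nonzero[of a z] assms by (simp add: disk_aut_def norm_divide divide_less_eq)
qed

lemma disk_aut_involution:
  assumes "norm a < 1" "norm z < 1"
  shows "disk_aut a (disk_aut a z) = z"
proof -
  define d where "d = 1 - cnj a * z"
  have d: "d \<noteq> 0" using disk_aut_denom_nonzero[of a z] assms by (simp add: d_def)
  have n: "1 - cnj a * a \<noteq> 0" using disk_aut_denom_nonzero[of a a] assms by simp
  have 1: "a - (a - z) / d = z * (1 - cnj a * a) / d"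
    using d by (simp add: field_simps) (simp add: d_def algebra_simps)
  have 2: "1 - cnj a * ((a - z) / d) = (1 - cnj a * a) / d"
    using d by (simp add: field_simps) (simp add: d_def algebra_simps)
  show ?thesis unfolding disk_aut_def d_def[symmetric] 1 2 using d n by simp
qed

text \<open>Finiteness of the supremum over \<open>a\<close> yields a real bound \<open>c\<close> on
  the square roots of the means, so \<open>c^2\<close> bounds the means themselves, uniformly in
  \<open>a\<close> and \<open>r\<close>.\<close>

lemma BMOA_bound:
  assumes "g \<in> BMOA"
  obtains C where "0 \<le> C"
    "\<And>a r. norm a < 1 \<Longrightarrow> 0 \<le> r \<Longrightarrow> r < 1 \<Longrightarrow> cmean r (\<lambda>z. (norm (g (disk_aut a z) - g a))\<^sup>2) \<le> C"
proof -
  have hol: "g holomorphic_on unit_disk" using assms by (simp add: BMOA_def hardy_space_def Hol_def)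
  let ?S = "SUP a\<in>unit_disk. hardy_norm 2 (\<lambda>z. g (disk_aut a z) - g a)"
  have "?S < \<infinity>" using assms by (simp add: BMOA_def)
  then obtain c where c: "?S = ennreal c" "0 \<le> c" by (cases ?S) auto
  have "cmean r (\<lambda>z. (norm (g (disk_aut a z) - g a))\<^sup>2) \<le> c\<^sup>2" if "norm a < 1" "0 \<le> r" "r < 1" for a r
  proof -
    let ?m = "cmean r (\<lambda>z. norm (g (disk_aut a z) - g a) powr 2)"
    have "ennreal (?m powr (1/2)) \<le> hardy_norm 2 (\<lambda>z. g (disk_aut a z) - g a)"
      unfolding hardy_norm_eq
      using that by (intro SUP_upper) auto
    also have "\<dots> \<le> ennreal c"
      unfolding c(1)[symmetric] using that by (intro SUP_upper) auto
    finally have "?m powr (1/2) \<le> c" using c by simp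
    moreover have "0 \<le> ?m"
    proof (rule cmean_nonneg)
      have "g \<circ> disk_aut a holomorphic_on unit_disk"
        using norm_disk_aut that
        by (intro holomorphic_on_compose_gen[OF holomorphic_on_subset[OF disk_aut_holomorphic] hol]) auto
      then have "continuous_on unit_disk (\<lambda>z. g (disk_aut a z))"
        using holomorphic_on_imp_continuous_on by (simp add: o_def)
      then show "continuous_on (sphere 0 \<bar>r\<bar>) (\<lambda>z. norm (g (disk_aut a z) - g a) powr 2)"
        using that
        by (intro continuous_on_norm_powr continuous_intros) (auto elim: continuous_on_subset)
    qed auto
    ultimately have "?m \<le> c\<^sup>2"
      by (simp add: powr_half_sqrt real_sqrt_le_iff sqrt_le_D)
    moreover have "?m = cmean r (\<lambda>z. (norm (g (disk_aut a z) - g a))\<^sup>2)"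
      by (simp add: powr_numeral)
    ultimately show ?thesis by simp
  qed
  then show ?thesis using that[of "c\<^sup>2"] by simp
qed

text \<open>Membership test for the lacunary series and the zero function below. Composition with
  \<open>disk_aut a\<close> keeps a bound, and subtracting \<open>g a\<close> at most doubles
  it.\<close>

lemma bounded_in_BMOA:
  assumes hol: "g holomorphic_on unit_disk" and bd: "\<And>z. norm z < 1 \<Longrightarrow> norm (g z) \<le> B"
  shows "g \<in> BMOA"
proof -
  have *: "hardy_norm 2 h \<le> ennreal ((c powr 2) powr (1/2))"
    if "continuous_on unit_disk h" "\<And>z. norm z < 1 \<Longrightarrow> norm (h z) \<le> c" for h :: "complex \<Rightarrow> complex" and c
    unfolding hardy_norm_eq
  proof (rule SUP_least)
    fix r :: real assume r: "r \<in> {0..<1}"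
    have cont: "continuous_on (sphere 0 \<bar>r\<bar>) (\<lambda>z. norm (h z) powr 2)"
      using r by (intro continuous_on_norm_powr continuous_on_subset[OF that(1)]) auto
    have nonneg: "0 \<le> cmean r (\<lambda>z. norm (h z) powr 2)" by (intro cmean_nonneg cont) auto
    have "norm (h z) powr 2 \<le> c powr 2" if "norm z = \<bar>r\<bar>" for z
      using r that \<open>\<And>z. norm z < 1 \<Longrightarrow> norm (h z) \<le> c\<close>[of z] by (intro powr_mono2) auto
    then have "cmean r (\<lambda>z. norm (h z) powr 2) \<le> cmean r (\<lambda>_. c powr 2)"
      by (intro cmean_mono cont continuous_on_const) auto
    then have "cmean r (\<lambda>z. norm (h z) powr 2) powr (1/2) \<le> (c powr 2) powr (1/2)"
      using nonneg by (intro powr_mono2) auto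
    then show "ennreal (cmean r (\<lambda>z. norm (h z) powr 2) powr (1/2)) \<le> ennreal ((c powr 2) powr (1/2))"
      by (rule ennreal_leI)
  qed
  have cg: "continuous_on unit_disk g" using hol by (rule holomorphic_on_imp_continuous_on)
  have "hardy_norm 2 (\<lambda>z. g (disk_aut a z) - g a) \<le> ennreal (((2*B) powr 2) powr (1/2))"
    if a: "a \<in> unit_disk" for a
  proof (rule *)
    have "g \<circ> disk_aut a holomorphic_on unit_disk"
      using norm_disk_aut a
      by (intro holomorphic_on_compose_gen[OF holomorphic_on_subset[OF disk_aut_holomorphic] hol]) auto
    then show "continuous_on unit_disk (\<lambda>z. g (disk_aut a z) - g a)"
      using holomorphic_on_imp_continuous_on by (auto simp: o_def intro!: continuous_intros)
    show "norm (g (disk_aut a z) - g a) \<le> 2*B" if "norm z < 1" for z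
      using norm_triangle_ineq4[of "g (disk_aut a z)" "g a"] bd[of a] bd[of "disk_aut a z"]
        norm_disk_aut[of a z] that a by simp
  qed
  then have "(SUP a\<in>unit_disk. hardy_norm 2 (\<lambda>z. g (disk_aut a z) - g a))
      \<le> ennreal (((2*B) powr 2) powr (1/2))"
    by (rule SUP_least)
  moreover have "hardy_norm 2 g \<le> ennreal ((B powr 2) powr (1/2))" using * cg bd by blast
  ultimately show ?thesis
    using hol by (auto simp: BMOA_def hardy_space_def Hol_def ennreal_less_top intro: le_less_trans)
qed


text \<open>On the convex disk \<open>f * deriv g\<close> has a primitive \<open>P\<close>, and the
  integral along the segment from 0 to \<open>z\<close> is \<open>P z - P 0\<close>.\<close>

lemma volterra_primitive:
  assumes f: "f holomorphic_on unit_disk" and g: "g holomorphic_on unit_disk"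
  shows "volterra g f 0 = 0"
    and "norm z < 1 \<Longrightarrow> (volterra g f has_field_derivative f z * deriv g z) (at z)"
    and "volterra g f holomorphic_on unit_disk"
proof -
  have "(\<lambda>w. f w * deriv g w) holomorphic_on unit_disk"
    using f g by (intro holomorphic_on_mult holomorphic_deriv) auto
  from holomorphic_convex_primitive'[OF convex_ball open_ball this] obtain P where P: "\<And>x. x \<in> unit_disk \<Longrightarrow> (P has_field_derivative f x * deriv g x) (at x within unit_disk)"
    by metis
  have eq: "volterra g f z = P z - P 0" if "z \<in> unit_disk" for z
  proof -
    have "path_image (linepath 0 z) \<subseteq> unit_disk"
      using that closed_segment_subset[of 0 unit_disk z] by auto
    then show ?thesis
      using contour_integral_primitive[of unit_disk P "\<lambda>w. f w * deriv g w" "linepath 0 z"] P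
      by (simp add: volterra_def contour_integral_unique)
  qed
  show der: "(volterra g f has_field_derivative f z * deriv g z) (at z)" if "norm z < 1" for z
  proof -
    have "(P has_field_derivative f z * deriv g z) (at z)"
      using P[of z] that by (simp add: at_within_open[OF _ open_ball])
    then have "((\<lambda>z. P z - P 0) has_field_derivative f z * deriv g z) (at z)"
      using DERIV_diff[OF _ DERIV_const] by fastforce
    then show ?thesis
      by (rule has_field_derivative_transform_within_open[OF _ open_ball[of 0 1]]) (use that eq in simp_all)
  qed
  show "volterra g f 0 = 0" using eq[of 0] by simp
  show "volterra g f holomorphic_on unit_disk"
    using der by (subst holomorphic_on_open[OF open_ball]) (auto simp: ball_def)
qed

section \<open>The Poisson integral\<close>

definition poisson_kernel :: "complex \<Rightarrow> complex \<Rightarrow> real" where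
  "poisson_kernel z w = Re ((w + z) / (w - z))"

text \<open>Harmonic functions enter only as real parts of holomorphic ones. Integration against the
  full kernel, whose real part is \<open>poisson_kernel\<close>, supplies the holomorphic
  function.\<close>

definition schwarz_integral :: "real \<Rightarrow> (complex \<Rightarrow> real) \<Rightarrow> complex \<Rightarrow> complex" where
  "schwarz_integral R k z = cmean R (\<lambda>w. of_real (k w) * ((w + z) / (w - z)))"

lemma poisson_kernel_eq:
  assumes "w \<noteq> z"
  shows "poisson_kernel z w = ((norm w)\<^sup>2 - (norm z)\<^sup>2) / (norm (w - z))\<^sup>2"
proof -
  have "(w + z) / (w - z) = (w + z) * cnj (w - z) / of_real ((norm (w - z))\<^sup>2)"
    by (rule complex_div_cnj[of "w + z" "w - z", simplified of_real_power[symmetric]])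
  moreover have "Re ((w + z) * cnj (w - z)) = (norm w)\<^sup>2 - (norm z)\<^sup>2"
    unfolding cmod_power2 by (simp add: algebra_simps power2_eq_square)
  ultimately show ?thesis unfolding poisson_kernel_def by (simp only: Re_divide_of_real)
qed

lemma poisson_kernel_nonneg:
  assumes "norm z < norm w"
  shows "0 \<le> poisson_kernel z w"
proof -
  have "(norm z)\<^sup>2 \<le> (norm w)\<^sup>2" using assms by (intro power_mono) auto
  then show ?thesis using assms by (subst poisson_kernel_eq) auto
qed

lemma poisson_kernel_continuous:
  assumes "norm z < R"
  shows "continuous_on (sphere 0 \<bar>R\<bar>) (poisson_kernel z)"
  unfolding poisson_kernel_def using assms by (intro continuous_intros) auto

text \<open>Differentiation under the integral sign: the derivative \<open>2 * w / (w - z)^2\<close>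
  of the kernel in \<open>z\<close> is jointly continuous while \<open>z\<close> stays off the
  circle.\<close>

lemma schwarz_integral_holomorphic:
  assumes k: "continuous_on (sphere 0 R) k" and R: "0 < R"
  shows "schwarz_integral R k holomorphic_on ball 0 R"
proof -
  have ne: "of_real R * cis t \<noteq> z" if "z \<in> ball 0 R" for z :: complex and t
    using that R by (auto simp: norm_mult)
  have ck: "continuous_on T (\<lambda>t. k (of_real R * cis t))" for T
    by (rule continuous_on_compose2[OF k]) (use R in \<open>auto simp: norm_mult intro!: continuous_intros\<close>)
  have "(\<lambda>z. integral (cbox 0 (2*pi)) (\<lambda>t. of_real (k (of_real R * cis t)) * ((of_real R * cis t + z) / (of_real R * cis t - z))))
      holomorphic_on ball 0 R"
  proof (rule leibniz_rule_holomorphic)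
    fix z :: complex and t assume z: "z \<in> ball 0 R"
    show "((\<lambda>z. of_real (k (of_real R * cis t)) * ((of_real R * cis t + z) / (of_real R * cis t - z))) has_field_derivative
      of_real (k (of_real R * cis t)) * (2 * (of_real R * cis t) / (of_real R * cis t - z)\<^sup>2)) (at z within ball 0 R)"
      using ne[OF z, of t] by (auto intro!: derivative_eq_intros simp: field_simps power2_eq_square)
  next
    fix z :: complex assume z: "z \<in> ball 0 R"
    show "(\<lambda>t. of_real (k (of_real R * cis t)) * ((of_real R * cis t + z) / (of_real R * cis t - z))) integrable_on cbox 0 (2*pi)"
      using ne[OF z] by (intro integrable_continuous continuous_intros ck) auto
  next
    have "continuous_on (ball 0 R \<times> cbox 0 (2*pi)) (\<lambda>y. k (of_real R * cis (snd y)))"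
      by (rule continuous_on_compose2[OF ck[of UNIV]]) (auto intro!: continuous_intros)
    then show "continuous_on (ball 0 R \<times> cbox 0 (2*pi))
      (\<lambda>(z, t). of_real (k (of_real R * cis t)) * (2 * (of_real R * cis t) / (of_real R * cis t - z)\<^sup>2))"
      unfolding case_prod_unfold using ne by (intro continuous_intros) auto
  qed auto
  then show ?thesis
    unfolding schwarz_integral_def cmean_def by (intro holomorphic_intros) auto
qed

lemma Re_schwarz_integral:
  assumes "continuous_on (sphere 0 \<bar>R\<bar>) k" "norm z < R"
  shows "Re (schwarz_integral R k z) = cmean R (\<lambda>w. k w * poisson_kernel z w)"
proof -
  have "continuous_on (sphere 0 \<bar>R\<bar>) (\<lambda>w. of_real (k w) * ((w + z) / (w - z)))"
    using assms by (intro continuous_intros) auto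
  from cmean_Re[OF this] show ?thesis
    unfolding schwarz_integral_def poisson_kernel_def by (simp del: times_divide_eq_right)
qed

text \<open>Cauchy's formula at \<open>z\<close> for \<open>w \<mapsto> h w (R\<^sup>2 - |z|\<^sup>2) / (R\<^sup>2 - cnj z w)\<close>.\<close>

lemma poisson_formula:
  assumes c: "continuous_on (cball 0 R) h" and h: "h holomorphic_on ball 0 R" and z: "norm z < R"
  shows "cmean R (\<lambda>w. of_real (poisson_kernel z w) * h w) = h z"
proof -
  have R: "0 < R" using z by (meson le_less_trans norm_ge_zero)
  have ne: "of_real (R\<^sup>2) - cnj z * w \<noteq> 0" if "norm w \<le> R" for w
  proof
    assume "of_real (R\<^sup>2) - cnj z * w = 0"
    then have "norm (cnj z * w) = norm (complex_of_real (R\<^sup>2))" by simp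
    then have "norm z * norm w = R * R" using R by (simp add: norm_mult power2_eq_square)
    moreover have "norm z * norm w \<le> norm z * R" using that by (intro mult_left_mono) auto
    moreover have "norm z * R < R * R" using z R by simp
    ultimately show False by simp
  qed
  define k where "k = (\<lambda>w. h w * of_real (R\<^sup>2 - (norm z)\<^sup>2) / (of_real (R\<^sup>2) - cnj z * w))"
  have kz: "k z = h z"
    unfolding k_def using ne[of z] z
    by (simp add: mult.commute[of "cnj z"] complex_norm_square[symmetric])
  have "((\<lambda>u. k u / (u - z)) has_contour_integral 2 * of_real pi * \<i> * k z) (circlepath 0 R)"
  proof (rule Cauchy_integral_circlepath)
    show "continuous_on (cball 0 R) k"
      unfolding k_def using ne by (intro continuous_intros c) auto
    show "k holomorphic_on ball 0 R"
      unfolding k_def using ne by (intro holomorphic_intros h) auto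
  qed (use z in simp)
  then have "((\<lambda>t. k (0 + of_real R * cis t) / (0 + of_real R * cis t - z) * of_real R * \<i> * cis t)
      has_integral 2 * of_real pi * \<i> * k z) {0..2*pi}"
    unfolding circlepath_def by (subst (asm) has_contour_integral_part_circlepath_iff) auto
  moreover have "k (0 + of_real R * cis t) / (0 + of_real R * cis t - z) * of_real R * \<i> * cis t
      = \<i> * (of_real (poisson_kernel z (of_real R * cis t)) * h (of_real R * cis t))" for t
  proof -
    define w where "w = of_real R * cis t"
    have nw: "norm w = R" using R by (simp add: w_def norm_mult)
    have wz: "w - z \<noteq> 0" and w0: "w \<noteq> 0" using nw z R by auto
    have cwz: "cnj w - cnj z \<noteq> 0" using wz by (metis complex_cnj_diff complex_cnj_zero_iff)
    \<comment> \<open>Here \<open>|w| = R\<close> enters: on the circle the denominator of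
      \<open>k\<close> becomes \<open>w * (cnj w - cnj z)\<close>, so that
      \<open>k w * w / (w - z)\<close> acquires the denominator \<open>|w - z|^2\<close> of the
      Poisson kernel.\<close>
    have ww: "of_real (R\<^sup>2) = w * cnj w" using nw complex_norm_square[of w] by simp
    have "k w / (w - z) * w = h w * of_real (R\<^sup>2 - (norm z)\<^sup>2) * (w / (w * cnj w - cnj z * w)) / (w - z)"
      unfolding k_def ww by simp
    also have "w / (w * cnj w - cnj z * w) = 1 / (cnj w - cnj z)"
      using w0 by (metis (no_types, lifting) divide_self_if mult.commute nonzero_mult_divide_mult_cancel_left right_diff_distrib mult.right_neutral)
    also have "h w * of_real (R\<^sup>2 - (norm z)\<^sup>2) * (1 / (cnj w - cnj z)) / (w - z)
      = of_real (R\<^sup>2 - (norm z)\<^sup>2) / of_real ((norm (w - z))\<^sup>2) * h w"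
      unfolding complex_norm_square by (simp add: mult.commute)
    also have "\<dots> = of_real (poisson_kernel z w) * h w"
      using wz nw by (subst poisson_kernel_eq) auto
    finally have "\<i> * (k w / (w - z) * w) = \<i> * (of_real (poisson_kernel z w) * h w)" by simp
    then show ?thesis by (simp add: w_def mult_ac)
  qed
  ultimately have "((\<lambda>t. \<i> * (of_real (poisson_kernel z (of_real R * cis t)) * h (of_real R * cis t)))
      has_integral 2 * of_real pi * \<i> * h z) {0..2*pi}"
    by (simp add: kz)
  then have "integral {0..2*pi} (\<lambda>t. \<i> * (of_real (poisson_kernel z (of_real R * cis t)) * h (of_real R * cis t)))
      = 2 * of_real pi * \<i> * h z"
    by (rule integral_unique)
  then have "\<i> * integral {0..2*pi} (\<lambda>t. of_real (poisson_kernel z (of_real R * cis t)) * h (of_real R * cis t))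
      = \<i> * (2 * of_real pi * h z)"
    by (simp add: mult_ac)
  then show ?thesis by (simp add: cmean_def)
qed

lemma poisson_formula_Re:
  assumes c: "continuous_on (cball 0 R) h" and h: "h holomorphic_on ball 0 R" and z: "norm z < R"
  shows "cmean R (\<lambda>w. Re (h w) * poisson_kernel z w) = Re (h z)"
proof -
  have R: "0 < R" using z by (meson le_less_trans norm_ge_zero)
  have "continuous_on (sphere 0 \<bar>R\<bar>) (\<lambda>w. of_real (poisson_kernel z w) * h w)"
    using R by (intro continuous_intros poisson_kernel_continuous[OF z] continuous_on_subset[OF c]) auto
  from cmean_Re[OF this] show ?thesis
    by (simp add: poisson_formula[OF assms] mult.commute[of "Re _"])
qed

text \<open>A variance identity. Apart from \<open>|h w - h z|^2\<close>, expanding the square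
  leaves the real part of a function \<open>l\<close> holomorphic in \<open>w\<close>; the Poisson
  formula evaluates it at \<open>z\<close>, where it equals \<open>|h z|^2\<close>.\<close>

lemma poisson_norm_diff_sq:
  assumes c: "continuous_on (cball 0 R) h" and h: "h holomorphic_on ball 0 R" and z: "norm z < R"
  shows "cmean R (\<lambda>w. (norm (h w))\<^sup>2 * poisson_kernel z w)
    = (norm (h z))\<^sup>2 + cmean R (\<lambda>w. (norm (h w - h z))\<^sup>2 * poisson_kernel z w)"
proof -
  have R: "0 < R" using z by (meson le_less_trans norm_ge_zero)
  have cs: "continuous_on (sphere 0 \<bar>R\<bar>) h"
    using R by (intro continuous_on_subset[OF c]) auto
  define l where "l = (\<lambda>w. 2 * cnj (h z) * h w - of_real ((norm (h z))\<^sup>2))"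
  have "(norm (h w))\<^sup>2 = (norm (h w - h z))\<^sup>2 + Re (l w)" for w
    unfolding l_def cmod_power2 by (simp add: power2_eq_square algebra_simps)
  then have "cmean R (\<lambda>w. (norm (h w))\<^sup>2 * poisson_kernel z w)
      = cmean R (\<lambda>w. (norm (h w - h z))\<^sup>2 * poisson_kernel z w + Re (l w) * poisson_kernel z w)"
    by (simp add: distrib_right)
  also have "\<dots> = cmean R (\<lambda>w. (norm (h w - h z))\<^sup>2 * poisson_kernel z w) + cmean R (\<lambda>w. Re (l w) * poisson_kernel z w)"
    unfolding l_def by (intro cmean_add continuous_intros cs poisson_kernel_continuous[OF z])
  also have "cmean R (\<lambda>w. Re (l w) * poisson_kernel z w) = Re (l z)"
    unfolding l_def by (intro poisson_formula_Re continuous_intros holomorphic_intros c h z)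
  also have "Re (l z) = (norm (h z))\<^sup>2"
    unfolding l_def cmod_power2 by (simp add: power2_eq_square)
  finally show ?thesis by simp
qed

lemma poisson_mono:
  assumes "continuous_on (sphere 0 \<bar>R\<bar>) k" "continuous_on (sphere 0 \<bar>R\<bar>) l" and z: "norm z < R"
    and "\<And>w. norm w = R \<Longrightarrow> k w \<le> l w"
  shows "cmean R (\<lambda>w. k w * poisson_kernel z w) \<le> cmean R (\<lambda>w. l w * poisson_kernel z w)"
proof -
  have R: "0 < R" using z by (meson le_less_trans norm_ge_zero)
  show ?thesis
    using R assms(4)
    by (intro cmean_mono continuous_intros assms(1,2) poisson_kernel_continuous[OF z] mult_right_mono poisson_kernel_nonneg)
       (auto simp: z)
qed

text \<open>The variance term in \<open>poisson_norm_diff_sq\<close> is nonnegative.\<close>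

lemma norm_sq_le_poisson:
  assumes c: "continuous_on (cball 0 R) h" and h: "h holomorphic_on ball 0 R" and z: "norm z < R"
  shows "(norm (h z))\<^sup>2 \<le> cmean R (\<lambda>w. (norm (h w))\<^sup>2 * poisson_kernel z w)"
proof -
  have R: "0 < R" using z by (meson le_less_trans norm_ge_zero)
  have "continuous_on (sphere 0 \<bar>R\<bar>) (\<lambda>w. (norm (h w - h z))\<^sup>2)"
    using R by (intro continuous_intros continuous_on_subset[OF c]) auto
  from poisson_mono[OF continuous_on_const this z, of 0] show ?thesis
    unfolding poisson_norm_diff_sq[OF assms] by simp
qed

text \<open>Transported by \<open>disk_aut a\<close>, the harmonic majorant of \<open>|g \<circ> disk_aut a - g a|\<^sup>2\<close> on a disk of
  radius \<open>r < 1\<close> majorizes \<open>|g - g a|\<^sup>2\<close> on \<open>cball 0 R\<close>, and its value at \<open>a\<close> is a circle mean of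
  \<open>|g \<circ> disk_aut a - g a|\<^sup>2\<close>.\<close>

lemma poisson_norm_diff_sq_le:
  assumes g: "g holomorphic_on unit_disk"
    and C: "\<And>a r. norm a < 1 \<Longrightarrow> 0 \<le> r \<Longrightarrow> r < 1 \<Longrightarrow> cmean r (\<lambda>z. (norm (g (disk_aut a z) - g a))\<^sup>2) \<le> C"
    and R: "R < 1" and a: "norm a < R"
  shows "cmean R (\<lambda>w. (norm (g w - g a))\<^sup>2 * poisson_kernel a w) \<le> C"
proof -
  have R0: "0 < R" using a by (meson le_less_trans norm_ge_zero)
  have a1: "norm a < 1" using a R by simp
  have da: "disk_aut a holomorphic_on unit_disk"
    by (rule holomorphic_on_subset[OF disk_aut_holomorphic[OF a1]]) auto
  have sub: "cball 0 R \<subseteq> unit_disk" using R by auto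
  have "continuous_on (cball 0 R) (\<lambda>w. norm (disk_aut a w))"
    using holomorphic_on_imp_continuous_on[OF holomorphic_on_subset[OF da sub]] by (intro continuous_intros)
  \<comment> \<open>Compactness gives one radius \<open>r < 1\<close> whose disk contains the image
    of \<open>cball 0 R\<close>; the bound \<open>C\<close> is available only on circles of radius
    below 1.\<close>
  from continuous_attains_sup[OF compact_cball _ this] obtain w0 where
    w0: "w0 \<in> cball 0 R" "\<And>w. w \<in> cball 0 R \<Longrightarrow> norm (disk_aut a w) \<le> norm (disk_aut a w0)"
    using R0 by force
  have "norm (disk_aut a w0) < 1" using norm_disk_aut[OF a1, of w0] w0(1) R by simp
  then obtain r where r: "norm (disk_aut a w0) < r" "r < 1" using dense by blast
  have r0: "0 < r" using r(1) by (meson le_less_trans norm_ge_zero)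
  have img: "norm (disk_aut a w) < r" if "norm w \<le> R" for w
    using w0(2)[of w] r that by simp
  define h where "h = (\<lambda>z. g (disk_aut a z) - g a)"
  have "g \<circ> disk_aut a holomorphic_on unit_disk"
    using norm_disk_aut[OF a1] by (intro holomorphic_on_compose_gen[OF da g]) auto
  then have h: "h holomorphic_on unit_disk"
    unfolding h_def o_def by (intro holomorphic_intros)
  have ch: "continuous_on (cball 0 r) h" "continuous_on (sphere 0 r) h"
    using holomorphic_on_imp_continuous_on[OF h] r by (auto elim!: continuous_on_subset)
  define K where "K = schwarz_integral r (\<lambda>z. (norm (h z))\<^sup>2)"
  have K: "K holomorphic_on ball 0 r"
    unfolding K_def using r0 by (intro schwarz_integral_holomorphic continuous_intros ch) auto
  have ReK: "Re (K z) = cmean r (\<lambda>w. (norm (h w))\<^sup>2 * poisson_kernel z w)" if "norm z < r" for z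
    unfolding K_def using r0 by (intro Re_schwarz_integral continuous_intros that) (use ch in auto)
  have maj: "(norm (h z))\<^sup>2 \<le> Re (K z)" if "norm z < r" for z
    unfolding ReK[OF that]
    using r by (intro norm_sq_le_poisson ch that holomorphic_on_subset[OF h]) auto
  \<comment> \<open>The Poisson kernel for the centre is 1 on the circle, so this value is a plain
    circle mean, the quantity that \<open>C\<close> bounds.\<close>
  have "Re (K 0) = cmean r (\<lambda>w. (norm (h w))\<^sup>2)"
    unfolding ReK[of 0, simplified, OF r0]
    by (rule cmean_cong) (use r0 in \<open>auto simp: poisson_kernel_def\<close>)
  then have K0: "Re (K 0) \<le> C" using C[OF a1, of r] r r0 by (simp add: h_def)
  have "K \<circ> disk_aut a holomorphic_on cball 0 R"
    using img by (intro holomorphic_on_compose_gen[OF holomorphic_on_subset[OF da sub] K]) auto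
  then have Kd: "(\<lambda>w. K (disk_aut a w)) holomorphic_on cball 0 R" by (simp add: o_def)
  have cKd: "continuous_on (cball 0 R) (\<lambda>w. K (disk_aut a w))"
    by (rule holomorphic_on_imp_continuous_on[OF Kd])
  have "cmean R (\<lambda>w. (norm (g w - g a))\<^sup>2 * poisson_kernel a w)
      \<le> cmean R (\<lambda>w. Re (K (disk_aut a w)) * poisson_kernel a w)"
  proof (rule poisson_mono[OF _ _ a])
    show "continuous_on (sphere 0 \<bar>R\<bar>) (\<lambda>w. (norm (g w - g a))\<^sup>2)"
      using R R0 by (intro continuous_intros continuous_on_subset[OF holomorphic_on_imp_continuous_on[OF g]]) auto
    show "continuous_on (sphere 0 \<bar>R\<bar>) (\<lambda>w. Re (K (disk_aut a w)))"
      using R0 by (intro continuous_intros continuous_on_subset[OF cKd]) auto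
    fix w :: complex assume w: "norm w = R"
    have "h (disk_aut a w) = g w - g a"
      using disk_aut_involution[OF a1, of w] w R by (simp add: h_def)
    then show "(norm (g w - g a))\<^sup>2 \<le> Re (K (disk_aut a w))"
      using maj[of "disk_aut a w"] img[of w] w by simp
  qed
  also have "\<dots> = Re (K (disk_aut a a))"
    by (rule poisson_formula_Re[OF cKd _ a]) (rule holomorphic_on_subset[OF Kd], auto)
  also have "disk_aut a a = 0" by (simp add: disk_aut_def)
  finally show ?thesis using K0 by simp
qed

text \<open>\<open>G\<close> is the Schwarz integral of \<open>|g|^2\<close> over the circle of
  radius \<open>R\<close>. The excess of \<open>Re (G z)\<close> over \<open>|g z|^2\<close> is the
  variance at \<open>z\<close>, which is nonnegative and, by the BMOA condition, at most a constant
  independent of \<open>R\<close>.\<close>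

lemma BMOA_harmonic_majorant:
  assumes g: "g \<in> BMOA"
  obtains C where "0 \<le> C" "\<And>R. 0 < R \<Longrightarrow> R < 1 \<Longrightarrow>
    \<exists>G. G holomorphic_on ball 0 R \<and>
      (\<forall>z\<in>ball 0 R. (norm (g z))\<^sup>2 \<le> Re (G z) \<and> Re (G z) \<le> (norm (g z))\<^sup>2 + C)"
proof -
  have hol: "g holomorphic_on unit_disk" using g by (simp add: BMOA_def hardy_space_def Hol_def)
  obtain C where C: "0 \<le> C"
    "\<And>a r. norm a < 1 \<Longrightarrow> 0 \<le> r \<Longrightarrow> r < 1 \<Longrightarrow> cmean r (\<lambda>z. (norm (g (disk_aut a z) - g a))\<^sup>2) \<le> C"
    using BMOA_bound[OF g] by blast
  show ?thesis
  proof (rule that[OF C(1)])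
    fix R :: real assume R: "0 < R" "R < 1"
    have hR: "g holomorphic_on ball 0 R" and cR: "continuous_on (cball 0 R) g" and cS: "continuous_on (sphere 0 R) g"
      using R by (auto intro!: holomorphic_on_subset[OF hol] continuous_on_subset[OF holomorphic_on_imp_continuous_on[OF hol]])
    let ?G = "schwarz_integral R (\<lambda>z. (norm (g z))\<^sup>2)"
    have "?G holomorphic_on ball 0 R"
      using R by (intro schwarz_integral_holomorphic continuous_intros cS) auto
    moreover have "(norm (g z))\<^sup>2 \<le> Re (?G z) \<and> Re (?G z) \<le> (norm (g z))\<^sup>2 + C" if z: "z \<in> ball 0 R" for z
    proof -
      have zR: "norm z < R" using z by simp
      have eq: "Re (?G z) = cmean R (\<lambda>w. (norm (g w))\<^sup>2 * poisson_kernel z w)"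
        using R by (intro Re_schwarz_integral continuous_intros zR) (use cS in auto)
      show ?thesis
        unfolding eq using norm_sq_le_poisson[OF cR hR zR] poisson_norm_diff_sq[OF cR hR zR]
          poisson_norm_diff_sq_le[OF hol C(2) R(2) zR] by simp
    qed
    ultimately show "\<exists>G. G holomorphic_on ball 0 R \<and>
      (\<forall>z\<in>ball 0 R. (norm (g z))\<^sup>2 \<le> Re (G z) \<and> Re (G z) \<le> (norm (g z))\<^sup>2 + C)" by blast
  qed
qed

section \<open>Subharmonic functions\<close>

text \<open>Here \<open>p\<close> and \<open>\<beta>\<close> are the Wirtinger derivatives \<open>u\<^sub>z\<close> and \<open>u\<^sub>z\<^sub>w\<close> with \<open>w = cnj z\<close>, so that the Laplacian of \<open>u\<close> is \<open>4 \<beta>\<close>.\<close>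

definition wirtinger ::
  "complex set \<Rightarrow> (complex \<Rightarrow> real) \<Rightarrow> (complex \<Rightarrow> complex) \<Rightarrow> (complex \<Rightarrow> real) \<Rightarrow> bool" where
  "wirtinger S u p \<beta> \<longleftrightarrow> (\<exists>\<alpha>. continuous_on S \<alpha> \<and> continuous_on S \<beta> \<and>
     (\<forall>z\<in>S. (u has_derivative (\<lambda>h. 2 * Re (p z * h))) (at z) \<and>
            (p has_derivative (\<lambda>h. \<alpha> z * h + of_real (\<beta> z) * cnj h)) (at z)))"

lemma wirtinger_continuous:
  assumes "wirtinger S u p \<beta>"
  shows "continuous_on S u" "continuous_on S p" "continuous_on S \<beta>"
proof -
  show "continuous_on S \<beta>" using assms unfolding wirtinger_def by blast
  show "continuous_on S u" "continuous_on S p"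
    using assms unfolding wirtinger_def continuous_on_eq_continuous_within
    by (meson has_derivative_at_withinI has_derivative_continuous)+
qed

lemma wirtinger_add:
  assumes "wirtinger S u p \<beta>" "wirtinger S v q \<gamma>"
  shows "wirtinger S (\<lambda>z. u z + v z) (\<lambda>z. p z + q z) (\<lambda>z. \<beta> z + \<gamma> z)"
proof -
  obtain \<alpha> where 1: "continuous_on S \<alpha>" "continuous_on S \<beta>"
    "\<And>z. z \<in> S \<Longrightarrow> (u has_derivative (\<lambda>h. 2 * Re (p z * h))) (at z)"
    "\<And>z. z \<in> S \<Longrightarrow> (p has_derivative (\<lambda>h. \<alpha> z * h + of_real (\<beta> z) * cnj h)) (at z)"
    using assms(1) unfolding wirtinger_def by blast
  obtain \<alpha>' where 2: "continuous_on S \<alpha>'" "continuous_on S \<gamma>"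
    "\<And>z. z \<in> S \<Longrightarrow> (v has_derivative (\<lambda>h. 2 * Re (q z * h))) (at z)"
    "\<And>z. z \<in> S \<Longrightarrow> (q has_derivative (\<lambda>h. \<alpha>' z * h + of_real (\<gamma> z) * cnj h)) (at z)"
    using assms(2) unfolding wirtinger_def by blast
  show ?thesis
    unfolding wirtinger_def
  proof (intro exI[of _ "\<lambda>z. \<alpha> z + \<alpha>' z"] conjI ballI)
    fix z assume z: "z \<in> S"
    show "((\<lambda>z. u z + v z) has_derivative (\<lambda>h. 2 * Re ((p z + q z) * h))) (at z)"
      using has_derivative_add[OF 1(3)[OF z] 2(3)[OF z]] by (simp add: algebra_simps)
    show "((\<lambda>z. p z + q z) has_derivative
        (\<lambda>h. (\<alpha> z + \<alpha>' z) * h + of_real (\<beta> z + \<gamma> z) * cnj h)) (at z)"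
      using has_derivative_add[OF 1(4)[OF z] 2(4)[OF z]] by (simp add: algebra_simps)
  qed (intro continuous_intros 1 2)+
qed

text \<open>The chain rule behind the results on scaling, powers, logarithms and exponentials
  below.\<close>

lemma wirtinger_compose:
  assumes W: "wirtinger S u p \<beta>"
    and k: "\<And>z. z \<in> S \<Longrightarrow> (k has_real_derivative k' (u z)) (at (u z))"
    and k': "\<And>z. z \<in> S \<Longrightarrow> (k' has_real_derivative k'' (u z)) (at (u z))"
    and k'': "continuous_on S (\<lambda>z. k'' (u z))"
  shows "wirtinger S (\<lambda>z. k (u z)) (\<lambda>z. of_real (k' (u z)) * p z)
    (\<lambda>z. k' (u z) * \<beta> z + k'' (u z) * (norm (p z))\<^sup>2)"
proof -
  note cont = wirtinger_continuous[OF W]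
  obtain \<alpha> where 1: "continuous_on S \<alpha>"
    "\<And>z. z \<in> S \<Longrightarrow> (u has_derivative (\<lambda>h. 2 * Re (p z * h))) (at z)"
    "\<And>z. z \<in> S \<Longrightarrow> (p has_derivative (\<lambda>h. \<alpha> z * h + of_real (\<beta> z) * cnj h)) (at z)"
    using W unfolding wirtinger_def by blast
  have c': "continuous_on S (\<lambda>z. k' (u z))"
  proof (rule continuous_at_imp_continuous_on, rule ballI)
    fix z assume z: "z \<in> S"
    show "isCont (\<lambda>z. k' (u z)) z"
      by (rule isCont_o2[OF has_derivative_continuous[OF 1(2)[OF z]] DERIV_isCont[OF k'[OF z]]])
  qed
  show ?thesis
    unfolding wirtinger_def
  proof (intro exI[of _ "\<lambda>z. of_real (k' (u z)) * \<alpha> z + of_real (k'' (u z)) * (p z)\<^sup>2"] conjI ballI)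
    show "continuous_on S (\<lambda>z. of_real (k' (u z)) * \<alpha> z + of_real (k'' (u z)) * (p z)\<^sup>2)"
      by (intro continuous_intros 1 c' k'' cont)
    show "continuous_on S (\<lambda>z. k' (u z) * \<beta> z + k'' (u z) * (norm (p z))\<^sup>2)"
      by (intro continuous_intros c' k'' cont)
    fix z assume z: "z \<in> S"
    have *: "((\<lambda>z. l (u z)) has_derivative (\<lambda>h. l' * (2 * Re (p z * h)))) (at z)"
      if "(l has_real_derivative l') (at (u z))" for l l'
      using has_derivative_compose[OF 1(2)[OF z] that[unfolded has_field_derivative_def]] .
    show "((\<lambda>z. k (u z)) has_derivative (\<lambda>h. 2 * Re (of_real (k' (u z)) * p z * h))) (at z)"
      using *[OF k[OF z]] by (simp add: algebra_simps)
    have "((\<lambda>z. of_real (k' (u z)) * p z) has_derivative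
      (\<lambda>h. of_real (k' (u z)) * (\<alpha> z * h + of_real (\<beta> z) * cnj h) + of_real (k'' (u z) * (2 * Re (p z * h))) * p z)) (at z)"
      by (intro has_derivative_mult 1(3)[OF z] has_derivative_of_real *[OF k'[OF z]])
    \<comment> \<open>This splits \<open>2 * Re (p z * h) * p z\<close> into its complex linear and
      antilinear parts in \<open>h\<close>, from which the new coefficients are read off.\<close>
    moreover have "of_real (2 * Re (p z * h)) * p z = (p z)\<^sup>2 * h + of_real ((norm (p z))\<^sup>2) * cnj h" for h
      unfolding complex_norm_square complex_add_cnj[symmetric]
      by (simp add: algebra_simps power2_eq_square)
    ultimately show "((\<lambda>z. of_real (k' (u z)) * p z) has_derivative
      (\<lambda>h. (of_real (k' (u z)) * \<alpha> z + of_real (k'' (u z)) * (p z)\<^sup>2) * h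
        + of_real (k' (u z) * \<beta> z + k'' (u z) * (norm (p z))\<^sup>2) * cnj h)) (at z)"
      by (simp only: of_real_mult[of "k'' (u z)"] mult.assoc of_real_add of_real_mult distrib_left distrib_right)
         (simp add: algebra_simps)
  qed
qed

lemma wirtinger_cmult:
  assumes "wirtinger S u p \<beta>"
  shows "wirtinger S (\<lambda>z. c * u z) (\<lambda>z. of_real c * p z) (\<lambda>z. c * \<beta> z)"
  using wirtinger_compose[OF assms, of "\<lambda>x. c * x" "\<lambda>_. c" "\<lambda>_. 0"]
  by (auto intro!: derivative_eq_intros)

text \<open>Since \<open>Re h = (h + cnj h) / 2\<close>, the first derivative is
  \<open>deriv h / 2\<close>; it is holomorphic, so its antilinear part vanishes.\<close>

lemma wirtinger_Re:
  assumes "open S" "h holomorphic_on S"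
  shows "wirtinger S (\<lambda>z. Re (h z)) (\<lambda>z. deriv h z / 2) (\<lambda>_. 0)"
  unfolding wirtinger_def
proof (intro exI[of _ "\<lambda>z. deriv (deriv h) z / 2"] conjI ballI)
  have h': "deriv h holomorphic_on S" and h'': "deriv (deriv h) holomorphic_on S"
    using assms by (auto intro!: holomorphic_deriv)
  show "continuous_on S (\<lambda>z. deriv (deriv h) z / 2)"
    using h'' by (intro continuous_intros holomorphic_on_imp_continuous_on) auto
  fix z assume z: "z \<in> S"
  have "(h has_derivative (*) (deriv h z)) (at z)"
    using holomorphic_derivI[OF assms(2,1) z] by (simp add: has_field_derivative_def)
  from has_derivative_Re[OF this]
  show "((\<lambda>z. Re (h z)) has_derivative (\<lambda>w. 2 * Re (deriv h z / 2 * w))) (at z)"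
    by (simp add: diff_divide_distrib right_diff_distrib)
  have "(deriv h has_derivative (*) (deriv (deriv h) z)) (at z)"
    using holomorphic_derivI[OF h' assms(1) z] by (simp add: has_field_derivative_def)
  then have "((\<lambda>z. deriv h z / 2) has_derivative (\<lambda>w. deriv (deriv h) z * w / 2)) (at z)"
    by (rule bounded_linear.has_derivative[OF bounded_linear_divide])
  then show "((\<lambda>z. deriv h z / 2) has_derivative (\<lambda>w. deriv (deriv h) z / 2 * w + of_real 0 * cnj w)) (at z)"
    by simp
qed auto

lemma wirtinger_norm_sq:
  assumes "open S" "h holomorphic_on S"
  shows "wirtinger S (\<lambda>z. (norm (h z))\<^sup>2) (\<lambda>z. deriv h z * cnj (h z)) (\<lambda>z. (norm (deriv h z))\<^sup>2)"
  unfolding wirtinger_def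
proof (intro exI[of _ "\<lambda>z. deriv (deriv h) z * cnj (h z)"] conjI ballI)
  have h': "deriv h holomorphic_on S" and h'': "deriv (deriv h) holomorphic_on S"
    using assms by (auto intro!: holomorphic_deriv)
  note cont = holomorphic_on_imp_continuous_on[OF assms(2)] holomorphic_on_imp_continuous_on[OF h']
    holomorphic_on_imp_continuous_on[OF h'']
  show "continuous_on S (\<lambda>z. deriv (deriv h) z * cnj (h z))"
    by (intro continuous_intros cont)
  show "continuous_on S (\<lambda>z. (norm (deriv h z))\<^sup>2)" by (intro continuous_intros cont)
  fix z assume z: "z \<in> S"
  have d: "(h has_derivative (\<lambda>w. deriv h z * w)) (at z)"
    using holomorphic_derivI[OF assms(2,1) z] by (simp add: has_field_derivative_def)
  have d': "(deriv h has_derivative (\<lambda>w. deriv (deriv h) z * w)) (at z)"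
    using holomorphic_derivI[OF h' assms(1) z] by (simp add: has_field_derivative_def)
  have dc: "((\<lambda>z. cnj (h z)) has_derivative (\<lambda>w. cnj (deriv h z * w))) (at z)"
    by (rule has_derivative_cnj[OF d])
  have "((\<lambda>z. Re (h z * cnj (h z))) has_derivative
     (\<lambda>w. Re (h z * cnj (deriv h z * w) + deriv h z * w * cnj (h z)))) (at z)"
    by (rule has_derivative_Re[OF has_derivative_mult[OF d dc]])
  moreover have "Re (h z * cnj (h z)) = (norm (h z))\<^sup>2" for z
    by (subst cmod_power2) (simp add: power2_eq_square)
  moreover have "Re (h z * cnj (deriv h z * w) + deriv h z * w * cnj (h z)) = 2 * Re (deriv h z * cnj (h z) * w)" for w
    by (simp add: algebra_simps)
  ultimately show "((\<lambda>z. (norm (h z))\<^sup>2) has_derivative (\<lambda>w. 2 * Re (deriv h z * cnj (h z) * w))) (at z)"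
    by simp
  have "((\<lambda>z. deriv h z * cnj (h z)) has_derivative
     (\<lambda>w. deriv h z * cnj (deriv h z * w) + deriv (deriv h) z * w * cnj (h z))) (at z)"
    by (rule has_derivative_mult[OF d' dc])
  then show "((\<lambda>z. deriv h z * cnj (h z)) has_derivative
     (\<lambda>w. deriv (deriv h) z * cnj (h z) * w + of_real ((norm (deriv h z))\<^sup>2) * cnj w)) (at z)"
    unfolding complex_norm_square by (simp add: algebra_simps)
qed

lemma wirtinger_powr:
  assumes W: "wirtinger S u p \<beta>" and pos: "\<And>z. z \<in> S \<Longrightarrow> 0 < u z"
  shows "wirtinger S (\<lambda>z. u z powr q) (\<lambda>z. of_real (q * u z powr (q-1)) * p z)
     (\<lambda>z. q * u z powr (q-1) * \<beta> z + q * (q-1) * u z powr (q-2) * (norm (p z))\<^sup>2)"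
proof (rule wirtinger_compose[OF W])
  have "continuous_on S (\<lambda>z. u z powr (q-2))"
    by (intro continuous_intros wirtinger_continuous[OF W]) (metis less_irrefl pos)
  then show "continuous_on S (\<lambda>z. q * (q-1) * u z powr (q-2))"
    by (rule continuous_on_mult_left)
  fix z assume z: "z \<in> S"
  show "((\<lambda>x. x powr q) has_real_derivative q * u z powr (q-1)) (at (u z))"
    using pos[OF z] by (auto intro!: derivative_eq_intros)
  show "((\<lambda>x. q * x powr (q-1)) has_real_derivative q * (q-1) * u z powr (q-2)) (at (u z))"
    using pos[OF z] by (auto intro!: derivative_eq_intros)
qed

text \<open>The hypothesis \<open>log\<close> says that \<open>ln u\<close> is subharmonic. It puts
  \<open>T = u powr (q-2) * |p|^2\<close> below \<open>U = u powr (q-1) * \<beta>\<close>, and then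
  \<open>q * (U + (q-1) * T)\<close> lies between \<open>q * U\<close> and \<open>q^2 * U\<close>,
  in the order decided by whether \<open>q\<close> exceeds 1.\<close>

lemma wirtinger_powr_bounds:
  assumes W: "wirtinger S u p \<beta>" and pos: "\<And>z. z \<in> S \<Longrightarrow> 0 < u z"
    and log: "\<And>z. z \<in> S \<Longrightarrow> (norm (p z))\<^sup>2 \<le> u z * \<beta> z" and q: "0 \<le> q"
  obtains s \<delta> where "wirtinger S (\<lambda>z. u z powr q) s \<delta>"
    "\<And>z. z \<in> S \<Longrightarrow> \<delta> z \<le> q * max 1 q * u z powr (q-1) * \<beta> z"
    "\<And>z. z \<in> S \<Longrightarrow> q * min 1 q * u z powr (q-1) * \<beta> z \<le> \<delta> z"
proof (rule that[OF wirtinger_powr[OF W pos]])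
  fix z assume z: "z \<in> S"
  define T where "T = u z powr (q-2) * (norm (p z))\<^sup>2"
  define U where "U = u z powr (q-1) * \<beta> z"
  have "u z powr (q-1) = u z powr (q-2) * u z"
    using pos[OF z] powr_add[of "u z" "q-2" 1] by simp
  then have TU: "T \<le> U"
    unfolding T_def U_def using mult_left_mono[OF log[OF z], of "u z powr (q-2)"] by (simp add: mult.assoc)
  have T0: "0 \<le> T" by (simp add: T_def)
  have eq: "q * u z powr (q-1) * \<beta> z + q * (q-1) * u z powr (q-2) * (norm (p z))\<^sup>2 = q * (U + (q-1) * T)"
    by (simp add: T_def U_def algebra_simps)
  have "U + (q-1) * T \<le> max 1 q * U \<and> min 1 q * U \<le> U + (q-1) * T"
  proof (cases "1 \<le> q")
    case True
    have "(q-1) * T \<le> (q-1) * U" "0 \<le> (q-1) * T" using True TU T0 by (auto intro!: mult_left_mono)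
    then show ?thesis using True by (simp add: algebra_simps)
  next
    case False
    have "(1-q) * T \<le> (1-q) * U" "0 \<le> (1-q) * T" using False TU T0 by (auto intro!: mult_left_mono)
    then show ?thesis using False by (simp add: algebra_simps)
  qed
  then have "q * (U + (q-1) * T) \<le> q * (max 1 q * U)" "q * (min 1 q * U) \<le> q * (U + (q-1) * T)"
    using q by (auto intro!: mult_left_mono)
  then show "q * u z powr (q-1) * \<beta> z + q * (q-1) * u z powr (q-2) * (norm (p z))\<^sup>2
      \<le> q * max 1 q * u z powr (q-1) * \<beta> z"
    and "q * min 1 q * u z powr (q-1) * \<beta> z
      \<le> q * u z powr (q-1) * \<beta> z + q * (q-1) * u z powr (q-2) * (norm (p z))\<^sup>2"
    unfolding eq by (simp_all add: U_def mult.assoc)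
qed

text \<open>By \<open>log\<close> the term \<open>q * ln u\<close> has nonnegative Laplacian, so
  that of the exponent is at least \<open>4 * \<gamma>\<close>; exponentiating multiplies by the
  exponential and adds a nonnegative squared gradient. Writing the product as one exponential
  reduces it to sums and the chain rule.\<close>

lemma wirtinger_exp_log:
  assumes V: "wirtinger S \<phi> s \<gamma>" and W: "wirtinger S u p \<beta>" and pos: "\<And>z. z \<in> S \<Longrightarrow> 0 < u z"
    and log: "\<And>z. z \<in> S \<Longrightarrow> (norm (p z))\<^sup>2 \<le> u z * \<beta> z" and q: "0 \<le> q"
  obtains s' \<delta> where "wirtinger S (\<lambda>z. exp (\<phi> z + q * ln (u z))) s' \<delta>"
    "\<And>z. z \<in> S \<Longrightarrow> exp (\<phi> z) * u z powr q * \<gamma> z \<le> \<delta> z"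
proof -
  note cu = wirtinger_continuous[OF W]
  have "wirtinger S (\<lambda>z. q * ln (u z)) (\<lambda>z. of_real (q / u z) * p z)
     (\<lambda>z. q / u z * \<beta> z + (- q / (u z)\<^sup>2) * (norm (p z))\<^sup>2)"
  proof (rule wirtinger_compose[OF W])
    show "continuous_on S (\<lambda>z. - q / (u z)\<^sup>2)"
      by (intro continuous_intros cu) (metis less_irrefl pos power_eq_0_iff)
    fix z assume z: "z \<in> S"
    show "((\<lambda>x. q * ln x) has_real_derivative q / u z) (at (u z))"
      using pos[OF z] by (auto intro!: derivative_eq_intros)
    show "((\<lambda>x. q / x) has_real_derivative - q / (u z)\<^sup>2) (at (u z))"
      using pos[OF z] by (auto intro!: derivative_eq_intros simp: power2_eq_square)
  qed
  note L = wirtinger_add[OF V this]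
  have cE: "continuous_on S (\<lambda>z. exp (\<phi> z + q * ln (u z)))"
    by (rule continuous_on_exp[OF wirtinger_continuous(1)[OF L]])
  let ?E = "\<lambda>z. exp (\<phi> z + q * ln (u z))"
  let ?t = "\<lambda>z. s z + of_real (q / u z) * p z"
  have "wirtinger S ?E (\<lambda>z. of_real (?E z) * ?t z)
     (\<lambda>z. ?E z * (\<gamma> z + (q / u z * \<beta> z + (- q / (u z)\<^sup>2) * (norm (p z))\<^sup>2)) + ?E z * (norm (?t z))\<^sup>2)"
    by (rule wirtinger_compose[OF L]) (auto intro!: DERIV_exp cE)
  moreover have "exp (\<phi> z) * u z powr q * \<gamma> z
     \<le> ?E z * (\<gamma> z + (q / u z * \<beta> z + (- q / (u z)\<^sup>2) * (norm (p z))\<^sup>2)) + ?E z * (norm (?t z))\<^sup>2"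
    if z: "z \<in> S" for z
  proof -
    have E: "?E z = exp (\<phi> z) * u z powr q"
      using pos[OF z] by (simp add: exp_add powr_def)
    have "q / (u z)\<^sup>2 * (norm (p z))\<^sup>2 \<le> q / (u z)\<^sup>2 * (u z * \<beta> z)"
      using q log[OF z] by (intro mult_left_mono) auto
    also have "\<dots> = q / u z * \<beta> z" using pos[OF z] by (simp add: power2_eq_square)
    finally have "?E z * \<gamma> z \<le> ?E z * (\<gamma> z + (q / u z * \<beta> z + (- q / (u z)\<^sup>2) * (norm (p z))\<^sup>2))"
      by (intro mult_left_mono) auto
    moreover have "0 \<le> ?E z * (norm (?t z))\<^sup>2" by simp
    ultimately show ?thesis unfolding E by linarith
  qed
  ultimately show ?thesis by (rule that)
qed

text \<open>Provides the hypothesis \<open>log\<close> of the preceding lemmas, by the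
  Cauchy-Schwarz inequality for the values and the derivatives of \<open>f\<close> and
  \<open>h\<close>. The summand 1 keeps the function positive at common zeros.\<close>

lemma wirtinger_one_plus_norm_sq:
  assumes S: "open S" and f: "f holomorphic_on S" and h: "h holomorphic_on S"
  obtains p where "wirtinger S (\<lambda>z. (norm (f z))\<^sup>2 + (norm (h z))\<^sup>2 + 1) p
      (\<lambda>z. (norm (deriv f z))\<^sup>2 + (norm (deriv h z))\<^sup>2)"
    "\<And>z. z \<in> S \<Longrightarrow> (norm (p z))\<^sup>2 \<le> ((norm (f z))\<^sup>2 + (norm (h z))\<^sup>2 + 1)
        * ((norm (deriv f z))\<^sup>2 + (norm (deriv h z))\<^sup>2)"
proof -
  have "wirtinger S (\<lambda>z. (norm (f z))\<^sup>2 + (norm (h z))\<^sup>2 + 1)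
      (\<lambda>z. deriv f z * cnj (f z) + deriv h z * cnj (h z) + deriv (\<lambda>_. 1) z / 2)
      (\<lambda>z. (norm (deriv f z))\<^sup>2 + (norm (deriv h z))\<^sup>2 + 0)"
    using wirtinger_add[OF wirtinger_add[OF wirtinger_norm_sq[OF S f] wirtinger_norm_sq[OF S h]]
      wirtinger_Re[OF S holomorphic_on_const[of 1 S]]] by simp
  then have W: "wirtinger S (\<lambda>z. (norm (f z))\<^sup>2 + (norm (h z))\<^sup>2 + 1)
      (\<lambda>z. deriv f z * cnj (f z) + deriv h z * cnj (h z))
      (\<lambda>z. (norm (deriv f z))\<^sup>2 + (norm (deriv h z))\<^sup>2)" by simp
  show ?thesis
  proof (rule that[OF W])
    fix z
    define x y u v where "x = norm (deriv f z)" and "y = norm (f z)" and "u = norm (deriv h z)" and "v = norm (h z)"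
    have "norm (deriv f z * cnj (f z) + deriv h z * cnj (h z)) \<le> x * y + u * v"
      by (rule norm_triangle_le) (simp add: norm_mult x_def y_def u_def v_def)
    then have "(norm (deriv f z * cnj (f z) + deriv h z * cnj (h z)))\<^sup>2 \<le> (x * y + u * v)\<^sup>2"
      by (intro power_mono) auto
    \<comment> \<open>Lagrange's identity, whose last square is dropped next.\<close>
    also have "\<dots> = (y\<^sup>2 + v\<^sup>2) * (x\<^sup>2 + u\<^sup>2) - (x * v - u * y)\<^sup>2" by algebra
    also have "\<dots> \<le> (y\<^sup>2 + v\<^sup>2 + 1) * (x\<^sup>2 + u\<^sup>2)" by (simp add: algebra_simps)
    finally show "(norm (deriv f z * cnj (f z) + deriv h z * cnj (h z)))\<^sup>2
       \<le> ((norm (f z))\<^sup>2 + (norm (h z))\<^sup>2 + 1) * ((norm (deriv f z))\<^sup>2 + (norm (deriv h z))\<^sup>2)"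
      by (simp only: x_def y_def u_def v_def)
  qed
qed

text \<open>With \<open>N x = \<integral> 2 Re (p (x e\<^sup>i\<^sup>t) x e\<^sup>i\<^sup>t) dt\<close>, the mean has radial derivative \<open>N x / (2 \<pi> x)\<close>,
  while \<open>x N' x\<close> is the integral of \<open>4 \<beta> x\<^sup>2\<close> up to a total derivative in \<open>t\<close>.\<close>

lemma wirtinger_sub_mean_value:
  assumes W: "wirtinger (ball 0 R) u p \<beta>" and nonneg: "\<And>z. z \<in> ball 0 R \<Longrightarrow> 0 \<le> \<beta> z"
    and r: "0 \<le> r" "r < R"
  shows "u 0 \<le> cmean r u"
proof -
  obtain \<alpha> where ca: "continuous_on (ball 0 R) \<alpha>"
    and du: "\<And>z. z \<in> ball 0 R \<Longrightarrow> (u has_derivative (\<lambda>h. 2 * Re (p z * h))) (at z)"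
    and dp: "\<And>z. z \<in> ball 0 R \<Longrightarrow> (p has_derivative (\<lambda>h. \<alpha> z * h + of_real (\<beta> z) * cnj h)) (at z)"
    using W unfolding wirtinger_def by blast
  note cont = wirtinger_continuous[OF W] ca
  define e where "e = (\<lambda>x t. complex_of_real x * cis t)"
  have e_in: "e x t \<in> ball 0 R" if "x \<in> {0..r}" for x t
    using that r by (simp add: e_def norm_mult)
  have ce: "continuous_on T (\<lambda>y. e (fst y) (snd y))" for T
    unfolding e_def by (intro continuous_intros)
  have comp: "continuous_on ({0..r} \<times> cbox 0 (2*pi)) (\<lambda>y. k (e (fst y) (snd y)))"
    if "continuous_on (ball 0 R) k" for k :: "complex \<Rightarrow> 'b::topological_space"
    by (rule continuous_on_compose2[OF that ce]) (use e_in in auto)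
  have comp1: "continuous_on T (\<lambda>t. k (e x t))"
    if "continuous_on (ball 0 R) k" "x \<in> {0..r}" for k :: "complex \<Rightarrow> 'b::topological_space" and x T
    by (rule continuous_on_compose2[OF that(1)]) (use e_in[OF that(2)] in \<open>auto simp: e_def intro!: continuous_intros\<close>)
  have dex: "((\<lambda>x. e x t) has_vector_derivative cis t) (at x within T)" for x t T
    unfolding e_def by (auto intro!: derivative_eq_intros)
  have det: "((\<lambda>t. e x t) has_vector_derivative \<i> * e x t) (at t within T)" for x t T
    unfolding e_def by (auto intro!: derivative_eq_intros simp: has_vector_derivative_def)
  have chain: "((\<lambda>x. k (c x)) has_vector_derivative k' c') (at x within T)"
    if "(k has_derivative k') (at (c x))" "(c has_vector_derivative c') (at x within T)"
    for k :: "complex \<Rightarrow> 'b::real_normed_vector" and k' c c' x T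
    using vector_derivative_diff_chain_within[OF that(2) has_derivative_at_withinI[OF that(1)]]
    by (simp add: o_def)
  define m where "m = (\<lambda>x. integral (cbox 0 (2*pi)) (\<lambda>t. u (e x t)))"
  define n where "n = (\<lambda>x. integral (cbox 0 (2*pi)) (\<lambda>t. 2 * Re (p (e x t) * e x t)))"
  define m' where "m' = (\<lambda>x. integral (cbox 0 (2*pi)) (\<lambda>t. 2 * Re (p (e x t) * cis t)))"
  define n' where "n' = (\<lambda>x. integral (cbox 0 (2*pi))
     (\<lambda>t. 2 * Re ((\<alpha> (e x t) * cis t + of_real (\<beta> (e x t)) * cnj (cis t)) * e x t + p (e x t) * cis t)))"
  have m': "(m has_vector_derivative m' x) (at x within {0..r})" if x: "x \<in> {0..r}" for x
    unfolding m_def m'_def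
  proof (rule leibniz_rule_vector_derivative)
    fix x t assume "x \<in> {0..r}"
    show "((\<lambda>x. u (e x t)) has_vector_derivative 2 * Re (p (e x t) * cis t)) (at x within {0..r})"
      by (rule chain[OF du[OF e_in] dex]) fact
  next
    fix x assume "x \<in> {0..r}"
    then show "(\<lambda>t. u (e x t)) integrable_on cbox 0 (2 * pi)"
      by (intro integrable_continuous comp1 cont)
  next
    show "continuous_on ({0..r} \<times> cbox 0 (2 * pi)) (\<lambda>(x, t). 2 * Re (p (e x t) * cis t))"
      unfolding case_prod_unfold by (intro continuous_intros comp cont)
  qed (use x in auto)
  have n': "(n has_vector_derivative n' x) (at x within {0..r})" if x: "x \<in> {0..r}" for x
    unfolding n_def n'_def
  proof (rule leibniz_rule_vector_derivative)
    fix x t assume x: "x \<in> {0..r}"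
    have "((\<lambda>x. p (e x t)) has_vector_derivative \<alpha> (e x t) * cis t + of_real (\<beta> (e x t)) * cnj (cis t)) (at x within {0..r})"
      by (rule chain[OF dp[OF e_in] dex]) fact
    from has_vector_derivative_mult[OF this dex[of t]]
    have "((\<lambda>x. p (e x t) * e x t) has_vector_derivative
      p (e x t) * cis t + (\<alpha> (e x t) * cis t + of_real (\<beta> (e x t)) * cnj (cis t)) * e x t) (at x within {0..r})" .
    from bounded_linear.has_vector_derivative[OF bounded_linear_Re this]
    have "((\<lambda>x. 2 * Re (p (e x t) * e x t)) has_vector_derivative
      2 * Re (p (e x t) * cis t + (\<alpha> (e x t) * cis t + of_real (\<beta> (e x t)) * cnj (cis t)) * e x t)) (at x within {0..r})"
      by (rule has_vector_derivative_mult_right)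
    then show "((\<lambda>x. 2 * Re (p (e x t) * e x t)) has_vector_derivative
      2 * Re ((\<alpha> (e x t) * cis t + of_real (\<beta> (e x t)) * cnj (cis t)) * e x t + p (e x t) * cis t)) (at x within {0..r})"
      by (simp only: add.commute)
  next
    fix x assume "x \<in> {0..r}"
    then show "(\<lambda>t. 2 * Re (p (e x t) * e x t)) integrable_on cbox 0 (2 * pi)"
      by (intro integrable_continuous continuous_intros comp1 cont)
  next
    show "continuous_on ({0..r} \<times> cbox 0 (2 * pi))
      (\<lambda>(x, t). 2 * Re ((\<alpha> (e x t) * cis t + of_real (\<beta> (e x t)) * cnj (cis t)) * e x t + p (e x t) * cis t))"
      unfolding case_prod_unfold by (intro continuous_intros comp cont ce)
  qed (use x in auto)
  have n'_nonneg: "0 \<le> n' x" if x: "x \<in> {0..r}" and "0 < x" for x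
  proof -
    \<comment> \<open>\<open>w\<close> is the derivative of \<open>u (e x t)\<close> in
      \<open>t\<close>. It has period \<open>2 * pi\<close>, so its own derivative \<open>w'\<close>
      integrates to 0.\<close>
    define w where "w = (\<lambda>t. 2 * Re (p (e x t) * (\<i> * e x t)))"
    define w' where "w' = (\<lambda>t. 2 * Re ((\<alpha> (e x t) * (\<i> * e x t) + of_real (\<beta> (e x t)) * cnj (\<i> * e x t)) * (\<i> * e x t)
        + p (e x t) * (\<i> * (\<i> * e x t))))"
    have "(w has_vector_derivative w' t) (at t within {0..2*pi})" for t
    proof -
      have "((\<lambda>t. p (e x t)) has_vector_derivative \<alpha> (e x t) * (\<i> * e x t) + of_real (\<beta> (e x t)) * cnj (\<i> * e x t)) (at t within {0..2*pi})"
        by (rule chain[OF dp[OF e_in[OF x]] det])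
      from has_vector_derivative_mult[OF this has_vector_derivative_mult_right[OF det, of "\<i>"]]
      have "((\<lambda>t. p (e x t) * (\<i> * e x t)) has_vector_derivative
         p (e x t) * (\<i> * (\<i> * e x t)) + (\<alpha> (e x t) * (\<i> * e x t) + of_real (\<beta> (e x t)) * cnj (\<i> * e x t)) * (\<i> * e x t)) (at t within {0..2*pi})" .
      from has_vector_derivative_mult_right[OF bounded_linear.has_vector_derivative[OF bounded_linear_Re this], of 2]
      show ?thesis unfolding w_def w'_def by (simp only: add.commute)
    qed
    then have "(w' has_integral (w (2*pi) - w 0)) {0..2*pi}"
      by (intro fundamental_theorem_of_calculus) auto
    moreover have "w (2*pi) = w 0" by (simp add: w_def e_def)
    ultimately have iw: "(w' has_integral 0) {0..2*pi}" by simp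
    let ?F = "\<lambda>t. 2 * Re ((\<alpha> (e x t) * cis t + of_real (\<beta> (e x t)) * cnj (cis t)) * e x t + p (e x t) * cis t)"
    have "?F integrable_on {0..2*pi}"
      by (intro integrable_continuous_real continuous_intros comp1 cont x)
    then have iF: "(?F has_integral n' x) {0..2*pi}"
      by (simp add: n'_def integrable_integral)
    \<comment> \<open>Because \<open>\<i>^2 = -1\<close>, the terms with \<open>\<alpha>\<close> and
      with \<open>p\<close> cancel and the two terms with \<open>\<beta>\<close> add up.\<close>
    have "x * ?F t + w' t = 4 * x\<^sup>2 * \<beta> (e x t)" for t
    proof -
      have 1: "of_real x * cis t = e x t" by (simp add: e_def)
      have 2: "e x t * cnj (e x t) = of_real (x\<^sup>2)"
        unfolding complex_norm_square[symmetric] by (simp add: e_def norm_mult)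
      have "x * ?F t = 2 * Re (of_real x * ((\<alpha> (e x t) * cis t + of_real (\<beta> (e x t)) * cnj (cis t)) * e x t + p (e x t) * cis t))"
        by simp
      also have "of_real x * ((\<alpha> (e x t) * cis t + of_real (\<beta> (e x t)) * cnj (cis t)) * e x t + p (e x t) * cis t)
         = (\<alpha> (e x t) * e x t + of_real (\<beta> (e x t)) * cnj (e x t)) * e x t + p (e x t) * e x t"
        unfolding 1[symmetric] by (simp add: algebra_simps)
      finally have "x * ?F t + w' t = 2 * Re ((\<alpha> (e x t) * e x t + of_real (\<beta> (e x t)) * cnj (e x t)) * e x t + p (e x t) * e x t
        + ((\<alpha> (e x t) * (\<i> * e x t) + of_real (\<beta> (e x t)) * cnj (\<i> * e x t)) * (\<i> * e x t)
        + p (e x t) * (\<i> * (\<i> * e x t))))"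
        by (simp add: w'_def)
      also have "\<dots> = 2 * Re (2 * of_real (\<beta> (e x t)) * (e x t * cnj (e x t)))"
        by (simp add: algebra_simps)
      finally show ?thesis unfolding 2 by simp
    qed
    moreover have "((\<lambda>t. x * ?F t + w' t) has_integral (x * n' x + 0)) {0..2*pi}"
      by (intro has_integral_add has_integral_mult_right iF iw)
    ultimately have "((\<lambda>t. 4 * x\<^sup>2 * \<beta> (e x t)) has_integral x * n' x) {0..2*pi}" by simp
    then have "0 \<le> x * n' x"
      by (rule has_integral_nonneg) (use nonneg e_in[OF x] in auto)
    then show ?thesis using \<open>0 < x\<close> by (simp add: zero_le_mult_iff)
  qed
  have mono: "k 0 \<le> k x" if x: "x \<in> {0..r}"
    and d: "\<And>x. x \<in> {0..r} \<Longrightarrow> (k has_vector_derivative k' x) (at x within {0..r})"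
    and k': "\<And>x. x \<in> {0..r} \<Longrightarrow> 0 < x \<Longrightarrow> 0 \<le> k' x" for k k' :: "real \<Rightarrow> real" and x
  proof (rule DERIV_nonneg_imp_increasing_open[of 0 x k])
    have "continuous_on {0..r} k"
      using d has_vector_derivative_continuous continuous_on_eq_continuous_within by blast
    then show "continuous_on {0..x} k" by (rule continuous_on_subset) (use x in auto)
    fix y assume y: "0 < y" "y < x"
    then have "at y within {0..r} = at y" using x by (intro at_within_interior) simp
    then show "\<exists>l. DERIV k y :> l \<and> 0 \<le> l"
      using d[of y] k'[of y] x y by (auto simp: has_real_derivative_iff_has_vector_derivative)
  qed (use x in auto)
  \<comment> \<open>Monotonicity is used twice: first for \<open>n\<close>, which starts from
    \<open>n 0 = 0\<close>, and then, through the sign of \<open>n x = x * m' x\<close>, for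
    \<open>m\<close>.\<close>
  have m'_nonneg: "0 \<le> m' x" if x: "x \<in> {0..r}" and "0 < x" for x
  proof -
    have "2 * Re (p (e x t) * e x t) = x * (2 * Re (p (e x t) * cis t))" for t
      by (simp add: e_def algebra_simps)
    then have "n x = x * m' x" by (simp add: n_def m'_def)
    moreover have "n 0 \<le> n x" by (rule mono[OF x n' n'_nonneg])
    moreover have "n 0 = 0" by (simp add: n_def e_def)
    ultimately show ?thesis using \<open>0 < x\<close> by (simp add: zero_le_mult_iff)
  qed
  have "m 0 \<le> m r" by (rule mono[OF _ m' m'_nonneg]) (use r in auto)
  moreover have "m 0 = 2 * pi * u 0" by (simp add: m_def e_def)
  moreover have "m r = 2 * pi * cmean r u" by (simp add: m_def e_def cmean_def)
  ultimately show ?thesis by simp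
qed

section \<open>Boundedness of the Volterra operator\<close>

lemma wirtinger_lincomb:
  assumes "wirtinger S u p \<beta>" "wirtinger S v s \<gamma>" "wirtinger S w t \<delta>"
  obtains x where "wirtinger S (\<lambda>z. A * u z + B * v z + C * w z) x (\<lambda>z. A * \<beta> z + B * \<gamma> z + C * \<delta> z)"
  using wirtinger_add[OF wirtinger_add[OF wirtinger_cmult[OF assms(1)] wirtinger_cmult[OF assms(2)]]
    wirtinger_cmult[OF assms(3)]] by blast

lemma wirtinger_one_plus_norm_sq1:
  assumes "open S" "f holomorphic_on S"
  obtains p where "wirtinger S (\<lambda>z. (norm (f z))\<^sup>2 + 1) p (\<lambda>z. (norm (deriv f z))\<^sup>2)"
    "\<And>z. z \<in> S \<Longrightarrow> (norm (p z))\<^sup>2 \<le> ((norm (f z))\<^sup>2 + 1) * (norm (deriv f z))\<^sup>2"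
  using wirtinger_one_plus_norm_sq[OF assms holomorphic_on_const[of 0]] by auto

lemma cmean_lincomb:
  assumes "continuous_on (sphere 0 \<bar>r\<bar>) u" "continuous_on (sphere 0 \<bar>r\<bar>) v" "continuous_on (sphere 0 \<bar>r\<bar>) w"
  shows "cmean r (\<lambda>z. A * u z + B * v z + C * w z :: real) = A * cmean r u + B * cmean r v + C * cmean r w"
  using assms by (simp add: cmean_add cmean_cmult continuous_on_add continuous_on_mult_left)

section \<open>Mean estimates on a disk of radius \<open>R\<close>\<close>

text \<open>\<open>F\<close> stands for \<open>volterra g f\<close> and \<open>G\<close> for the
  function from \<open>BMOA_harmonic_majorant\<close>, so \<open>M\<close> is independent of
  \<open>R\<close>. The bounds derived here involve \<open>R\<close> only through the range of
  \<open>r\<close>.\<close>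

locale volterra_pair =
  fixes R M :: real and f g F G :: "complex \<Rightarrow> complex"
  assumes hol: "f holomorphic_on ball 0 R" "g holomorphic_on ball 0 R" "F holomorphic_on ball 0 R"
      "G holomorphic_on ball 0 R"
    and F0: "F 0 = 0" and F': "\<And>z. z \<in> ball 0 R \<Longrightarrow> deriv F z = f z * deriv g z"
    and maj: "\<And>z. z \<in> ball 0 R \<Longrightarrow> (norm (g z))\<^sup>2 \<le> Re (G z)"
      "\<And>z. z \<in> ball 0 R \<Longrightarrow> Re (G z) \<le> (norm (g z))\<^sup>2 + M"
begin

definition "\<phi> z = (norm (g z))\<^sup>2 - Re (G z)"

lemma \<phi>: "z \<in> ball 0 R \<Longrightarrow> - M \<le> \<phi> z" "z \<in> ball 0 R \<Longrightarrow> \<phi> z \<le> 0"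
  using maj[of z] by (simp_all add: \<phi>_def)

lemma exp_\<phi>: "z \<in> ball 0 R \<Longrightarrow> exp (- M) \<le> exp (\<phi> z)" "z \<in> ball 0 R \<Longrightarrow> exp (\<phi> z) \<le> 1"
  using \<phi> by auto

lemma \<phi>_wirtinger: obtains s where "wirtinger (ball 0 R) \<phi> s (\<lambda>z. (norm (deriv g z))\<^sup>2)"
  using wirtinger_add[OF wirtinger_norm_sq[OF open_ball hol(2)]
    wirtinger_cmult[OF wirtinger_Re[OF open_ball hol(4)], of "-1"]]
  unfolding \<phi>_def by auto

text \<open>The substitute for the Carleson embedding: since \<open>\<phi>\<close> is bounded, the
  weight \<open>exp (\<phi> z)\<close> costs at most a factor \<open>exp M\<close> and yields a
  Laplacian controlling \<open>|deriv g|^2\<close>. It is applied with \<open>h = f\<close> and with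
  \<open>h = F\<close>.\<close>

lemma exp_mult_wirtinger:
  assumes "h holomorphic_on ball 0 R" "0 \<le> q"
  obtains s \<delta> where "wirtinger (ball 0 R) (\<lambda>z. exp (\<phi> z + q * ln ((norm (h z))\<^sup>2 + 1))) s \<delta>"
    "\<And>z. z \<in> ball 0 R \<Longrightarrow> exp (- M) * ((norm (h z))\<^sup>2 + 1) powr q * (norm (deriv g z))\<^sup>2 \<le> \<delta> z"
proof -
  obtain s where s: "wirtinger (ball 0 R) \<phi> s (\<lambda>z. (norm (deriv g z))\<^sup>2)" by (rule \<phi>_wirtinger)
  obtain p where p: "wirtinger (ball 0 R) (\<lambda>z. (norm (h z))\<^sup>2 + 1) p (\<lambda>z. (norm (deriv h z))\<^sup>2)"
    "\<And>z. z \<in> ball 0 R \<Longrightarrow> (norm (p z))\<^sup>2 \<le> ((norm (h z))\<^sup>2 + 1) * (norm (deriv h z))\<^sup>2"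
    using wirtinger_one_plus_norm_sq1[OF open_ball assms(1)] by blast
  have pos: "0 < (norm (h z))\<^sup>2 + 1" for z by (rule add_nonneg_pos) auto
  obtain s' \<delta> where d: "wirtinger (ball 0 R) (\<lambda>z. exp (\<phi> z + q * ln ((norm (h z))\<^sup>2 + 1))) s' \<delta>"
    "\<And>z. z \<in> ball 0 R \<Longrightarrow> exp (\<phi> z) * ((norm (h z))\<^sup>2 + 1) powr q * (norm (deriv g z))\<^sup>2 \<le> \<delta> z"
    using wirtinger_exp_log[OF s p(1) pos p(2) assms(2)] by blast
  show ?thesis
  proof (rule that[OF d(1)])
    fix z :: complex assume z: "z \<in> ball 0 R"
    have "exp (- M) * ((norm (h z))\<^sup>2 + 1) powr q * (norm (deriv g z))\<^sup>2
        \<le> exp (\<phi> z) * ((norm (h z))\<^sup>2 + 1) powr q * (norm (deriv g z))\<^sup>2"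
      using exp_\<phi>[OF z] by (intro mult_right_mono) auto
    with d(2)[OF z] show "exp (- M) * ((norm (h z))\<^sup>2 + 1) powr q * (norm (deriv g z))\<^sup>2 \<le> \<delta> z" by simp
  qed
qed

lemma exp_add_ln:
  fixes h :: "complex \<Rightarrow> complex"
  shows "exp (\<phi> z + q * ln ((norm (h z))\<^sup>2 + 1)) = exp (\<phi> z) * ((norm (h z))\<^sup>2 + 1) powr q"
proof -
  have "(norm (h z))\<^sup>2 + 1 \<noteq> 0" by (metis add_nonneg_pos less_irrefl zero_le_power2 zero_less_one)
  then show ?thesis by (simp add: exp_add powr_def)
qed

lemma exp_mult_le:
  fixes h :: "complex \<Rightarrow> complex"
  assumes "z \<in> ball 0 R"
  shows "exp (\<phi> z + q * ln ((norm (h z))\<^sup>2 + 1)) \<le> ((norm (h z))\<^sup>2 + 1) powr q"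
  unfolding exp_add_ln using mult_right_mono[OF exp_\<phi>(2)[OF assms], of "((norm (h z))\<^sup>2 + 1) powr q"] by simp

text \<open>With \<open>a = |f|\<^sup>2 + 1\<close> and \<open>b = |F|\<^sup>2 + |f|\<^sup>2 + 1\<close>, the function
  \<open>q e\<^sup>M e\<^sup>\<phi> a\<^sup>q + a\<^sup>q / q - b\<^sup>q\<close> is subharmonic: since \<open>q \<le> 1\<close>, the weight \<open>b\<^bsup>q-1\<^esup>\<close> in the Laplacian of \<open>b\<^sup>q\<close> is at
  most \<open>a\<^bsup>q-1\<^esup>\<close>.\<close>

lemma mean_bound_small_exponent:
  assumes q: "0 < q" "q \<le> 1" and r: "0 \<le> r" "r < R"
  shows "cmean r (\<lambda>z. ((norm (F z))\<^sup>2 + 1) powr q)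
    \<le> (q * exp M + 1 / q) * cmean r (\<lambda>z. ((norm (f z))\<^sup>2 + 1) powr q) + ((norm (f 0))\<^sup>2 + 1) powr q"
proof -
  define a where "a = (\<lambda>z. (norm (f z))\<^sup>2 + 1)"
  define b where "b = (\<lambda>z. (norm (F z))\<^sup>2 + (norm (f z))\<^sup>2 + 1)"
  have apos: "0 < a z" for z unfolding a_def by (rule add_nonneg_pos) auto
  have ab: "a z \<le> b z" for z by (simp add: a_def b_def)
  have bpos: "0 < b z" for z using apos ab by (rule less_le_trans)
  obtain p where p: "wirtinger (ball 0 R) a p (\<lambda>z. (norm (deriv f z))\<^sup>2)"
    "\<And>z. z \<in> ball 0 R \<Longrightarrow> (norm (p z))\<^sup>2 \<le> a z * (norm (deriv f z))\<^sup>2"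
    using wirtinger_one_plus_norm_sq1[OF open_ball hol(1)] unfolding a_def by blast
  obtain p' where p': "wirtinger (ball 0 R) b p' (\<lambda>z. (norm (deriv F z))\<^sup>2 + (norm (deriv f z))\<^sup>2)"
    "\<And>z. z \<in> ball 0 R \<Longrightarrow> (norm (p' z))\<^sup>2 \<le> b z * ((norm (deriv F z))\<^sup>2 + (norm (deriv f z))\<^sup>2)"
    using wirtinger_one_plus_norm_sq[OF open_ball hol(3,1)] unfolding b_def by blast
  have q0: "0 \<le> q" using q by simp
  obtain s1 \<delta>1 where 1: "wirtinger (ball 0 R) (\<lambda>z. exp (\<phi> z + q * ln (a z))) s1 \<delta>1"
    "\<And>z. z \<in> ball 0 R \<Longrightarrow> exp (- M) * a z powr q * (norm (deriv g z))\<^sup>2 \<le> \<delta>1 z"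
    using exp_mult_wirtinger[OF hol(1) q0] unfolding a_def by blast
  obtain s2 \<delta>2 where 2: "wirtinger (ball 0 R) (\<lambda>z. a z powr q) s2 \<delta>2"
    "\<And>z. z \<in> ball 0 R \<Longrightarrow> q * min 1 q * a z powr (q-1) * (norm (deriv f z))\<^sup>2 \<le> \<delta>2 z"
    using wirtinger_powr_bounds[OF p(1) apos p(2) q0] by metis
  obtain s3 \<delta>3 where 3: "wirtinger (ball 0 R) (\<lambda>z. b z powr q) s3 \<delta>3"
    "\<And>z. z \<in> ball 0 R \<Longrightarrow> \<delta>3 z \<le> q * max 1 q * b z powr (q-1) * ((norm (deriv F z))\<^sup>2 + (norm (deriv f z))\<^sup>2)"
    using wirtinger_powr_bounds[OF p'(1) bpos p'(2) q0] by metis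
  let ?e = "\<lambda>z. exp (\<phi> z + q * ln (a z))"
  \<comment> \<open>The first coefficient cancels \<open>exp (- M)\<close> in the bound for
    \<open>\<delta>1\<close>, the second one factor of \<open>q * min 1 q = q^2\<close> in that for
    \<open>\<delta>2\<close>. Both bounds then carry the factor \<open>q\<close> of the upper bound
    for \<open>\<delta>3\<close>.\<close>
  let ?D = "\<lambda>z. q * exp M * ?e z + 1 / q * a z powr q + (-1) * b z powr q"
  obtain x where W: "wirtinger (ball 0 R) ?D x (\<lambda>z. q * exp M * \<delta>1 z + 1 / q * \<delta>2 z + (-1) * \<delta>3 z)"
    by (rule wirtinger_lincomb[OF 1(1) 2(1) 3(1)])
  have "?D 0 \<le> cmean r ?D"
  proof (rule wirtinger_sub_mean_value[OF W _ r])
    fix z :: complex assume z: "z \<in> ball 0 R"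
    define X Y where "X = (norm (deriv g z))\<^sup>2" and "Y = (norm (deriv f z))\<^sup>2"
    have XY: "0 \<le> X" "0 \<le> Y" by (simp_all add: X_def Y_def)
    have "q * exp M * (exp (- M) * a z powr q * X) \<le> q * exp M * \<delta>1 z"
      using 1(2)[OF z] q by (intro mult_left_mono) (auto simp: X_def)
    then have d1: "q * (a z powr q * X) \<le> q * exp M * \<delta>1 z" by (simp add: exp_minus field_simps)
    have "1 / q * (q * q * a z powr (q-1) * Y) \<le> 1 / q * \<delta>2 z"
      using 2(2)[OF z] q by (intro mult_left_mono) (auto simp: Y_def)
    then have d2: "q * (a z powr (q-1) * Y) \<le> 1 / q * \<delta>2 z" using q by simp
    have "(norm (f z))\<^sup>2 \<le> a z" by (simp add: a_def)
    then have "(norm (deriv F z))\<^sup>2 \<le> a z * X"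
      using XY by (simp add: F'[OF z] norm_mult power_mult_distrib X_def mult_right_mono)
    then have "b z powr (q-1) * ((norm (deriv F z))\<^sup>2 + Y) \<le> a z powr (q-1) * (a z * X + Y)"
      using q XY apos[of z] ab[of z] by (intro mult_mono powr_mono2') auto
    also have "\<dots> = a z powr q * X + a z powr (q-1) * Y"
      using apos[of z] powr_add[of "a z" "q-1" 1] by (simp add: algebra_simps)
    finally have "q * (b z powr (q-1) * ((norm (deriv F z))\<^sup>2 + Y)) \<le> q * (a z powr q * X + a z powr (q-1) * Y)"
      using q by (intro mult_left_mono) auto
    then have d3: "\<delta>3 z \<le> q * (a z powr q * X) + q * (a z powr (q-1) * Y)"
      using 3(2)[OF z] q by (simp add: Y_def algebra_simps)
    show "0 \<le> q * exp M * \<delta>1 z + 1 / q * \<delta>2 z + (-1) * \<delta>3 z"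
      using d1 d2 d3 by linarith
  qed
  have sub: "sphere 0 \<bar>r\<bar> \<subseteq> ball 0 R" using r by auto
  note cont = continuous_on_subset[OF wirtinger_continuous(1)[OF 1(1)] sub]
    continuous_on_subset[OF wirtinger_continuous(1)[OF 2(1)] sub]
    continuous_on_subset[OF wirtinger_continuous(1)[OF 3(1)] sub]
  have "cmean r ?D = q * exp M * cmean r ?e + 1 / q * cmean r (\<lambda>z. a z powr q) - cmean r (\<lambda>z. b z powr q)"
    by (subst cmean_lincomb[OF cont]) simp
  moreover have "cmean r ?e \<le> cmean r (\<lambda>z. a z powr q)"
    using r by (intro cmean_mono cont) (auto simp: a_def intro!: exp_mult_le)
  then have "q * exp M * cmean r ?e \<le> q * exp M * cmean r (\<lambda>z. a z powr q)"
    using q by (intro mult_left_mono) auto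
  \<comment> \<open>\<open>F 0 = 0\<close> makes \<open>b 0 = a 0\<close>, and the other terms are
    nonnegative; this produces the last summand of the claim.\<close>
  moreover have "- (a 0 powr q) \<le> ?D 0"
    using q F0 by (simp add: a_def b_def)
  moreover have "cmean r (\<lambda>z. ((norm (F z))\<^sup>2 + 1) powr q) \<le> cmean r (\<lambda>z. b z powr q)"
  proof (rule cmean_mono[OF _ cont(3)])
    have "continuous_on (sphere 0 \<bar>r\<bar>) (\<lambda>z. (norm (F z))\<^sup>2 + 1)"
      by (intro continuous_intros continuous_on_subset[OF holomorphic_on_imp_continuous_on[OF hol(3)] sub])
    then show "continuous_on (sphere 0 \<bar>r\<bar>) (\<lambda>z. ((norm (F z))\<^sup>2 + 1) powr q)"
      by (rule continuous_on_powr[OF _ continuous_on_const]) (metis add_nonneg_pos less_irrefl zero_le_power2 zero_less_one)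
    show "((norm (F z))\<^sup>2 + 1) powr q \<le> b z powr q" for z
      using q by (intro powr_mono2) (auto simp: b_def)
  qed
  ultimately show ?thesis
    using \<open>?D 0 \<le> cmean r ?D\<close> unfolding a_def by (simp add: distrib_right)
qed

text \<open>With \<open>a\<close> as before and \<open>c = |F|\<^sup>2 + 1\<close>, the function \<open>A e\<^sup>\<phi> a\<^sup>q - c\<^sup>q + e\<^sup>\<phi> c\<^sup>q / 2\<close> is subharmonic: the cross
  term in the Laplacian of \<open>c\<^sup>q\<close> satisfies \<open>c\<^bsup>q-1\<^esup> a \<le> d c\<^sup>q + d\<^bsup>1-q\<^esup> a\<^sup>q\<close> and \<open>e\<^sup>\<phi> c\<^sup>q / 2\<close> absorbs its first part.\<close>

lemma mean_bound_large_exponent: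
  fixes q :: real
  defines "d \<equiv> exp (- M) / (2 * q\<^sup>2)"
  assumes q: "1 \<le> q" and r: "0 \<le> r" "r < R"
  shows "cmean r (\<lambda>z. ((norm (F z))\<^sup>2 + 1) powr q)
    \<le> 2 * (q\<^sup>2 * d powr (1-q) * exp M) * cmean r (\<lambda>z. ((norm (f z))\<^sup>2 + 1) powr q) + 2"
proof -
  define a where "a = (\<lambda>z. (norm (f z))\<^sup>2 + 1)"
  define c where "c = (\<lambda>z. (norm (F z))\<^sup>2 + 1)"
  define A where "A = q\<^sup>2 * d powr (1-q) * exp M"
  have d0: "0 < d" using q by (simp add: d_def)
  have A0: "0 \<le> A" by (simp add: A_def)
  have apos: "0 < a z" and cpos: "0 < c z" for z
    unfolding a_def c_def by (auto intro: add_nonneg_pos)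
  obtain p where p: "wirtinger (ball 0 R) c p (\<lambda>z. (norm (deriv F z))\<^sup>2)"
    "\<And>z. z \<in> ball 0 R \<Longrightarrow> (norm (p z))\<^sup>2 \<le> c z * (norm (deriv F z))\<^sup>2"
    using wirtinger_one_plus_norm_sq1[OF open_ball hol(3)] unfolding c_def by blast
  have q0: "0 \<le> q" using q by simp
  obtain s1 \<delta>1 where 1: "wirtinger (ball 0 R) (\<lambda>z. exp (\<phi> z + q * ln (a z))) s1 \<delta>1"
    "\<And>z. z \<in> ball 0 R \<Longrightarrow> exp (- M) * a z powr q * (norm (deriv g z))\<^sup>2 \<le> \<delta>1 z"
    using exp_mult_wirtinger[OF hol(1) q0] unfolding a_def by blast
  obtain s2 \<delta>2 where 2: "wirtinger (ball 0 R) (\<lambda>z. exp (\<phi> z + q * ln (c z))) s2 \<delta>2"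
    "\<And>z. z \<in> ball 0 R \<Longrightarrow> exp (- M) * c z powr q * (norm (deriv g z))\<^sup>2 \<le> \<delta>2 z"
    using exp_mult_wirtinger[OF hol(3) q0] unfolding c_def by blast
  obtain s3 \<delta>3 where 3: "wirtinger (ball 0 R) (\<lambda>z. c z powr q) s3 \<delta>3"
    "\<And>z. z \<in> ball 0 R \<Longrightarrow> \<delta>3 z \<le> q * max 1 q * c z powr (q-1) * (norm (deriv F z))\<^sup>2"
    using wirtinger_powr_bounds[OF p(1) cpos p(2) q0] by metis
  let ?e = "\<lambda>u z. exp (\<phi> z + q * ln (u z))"
  let ?D = "\<lambda>z. A * ?e a z + 1 / 2 * ?e c z + (-1) * c z powr q"
  obtain x where W: "wirtinger (ball 0 R) ?D x (\<lambda>z. A * \<delta>1 z + 1 / 2 * \<delta>2 z + (-1) * \<delta>3 z)"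
    by (rule wirtinger_lincomb[OF 1(1) 2(1) 3(1)])
  have "?D 0 \<le> cmean r ?D"
  proof (rule wirtinger_sub_mean_value[OF W _ r])
    fix z :: complex assume z: "z \<in> ball 0 R"
    define X where "X = (norm (deriv g z))\<^sup>2"
    have X: "0 \<le> X" by (simp add: X_def)
    have "A * (exp (- M) * a z powr q * X) \<le> A * \<delta>1 z"
      using 1(2)[OF z] A0 by (intro mult_left_mono) (auto simp: X_def)
    then have d1: "q\<^sup>2 * (d powr (1-q) * a z powr q * X) \<le> A * \<delta>1 z"
      by (simp add: A_def exp_minus field_simps)
    \<comment> \<open>The constant \<open>d\<close> is chosen so that
      \<open>q^2 * d = exp (- M) / 2\<close>, which matches half of the lower bound for
      \<open>\<delta>2\<close>.\<close>
    have d2: "q\<^sup>2 * (d * c z powr q * X) \<le> 1 / 2 * \<delta>2 z"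
      using 2(2)[OF z] q by (simp add: X_def d_def field_simps)
    have "(norm (f z))\<^sup>2 \<le> a z" by (simp add: a_def)
    then have "(norm (deriv F z))\<^sup>2 \<le> a z * X"
      using X by (simp add: F'[OF z] norm_mult power_mult_distrib X_def mult_right_mono)
    then have "c z powr (q-1) * (norm (deriv F z))\<^sup>2 \<le> c z powr (q-1) * a z * X"
      by (simp add: mult.assoc mult_left_mono)
    \<comment> \<open>A Young-type inequality by cases: if \<open>a z <= d * c z\<close>, the first
      term dominates; otherwise \<open>c z < a z / d\<close> and the second one does.\<close>
    also have "c z powr (q-1) * a z \<le> d * c z powr q + d powr (1-q) * a z powr q"
    proof (cases "a z \<le> d * c z")
      case True
      then have "c z powr (q-1) * a z \<le> c z powr (q-1) * (d * c z)" by (intro mult_left_mono) auto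
      also have "\<dots> = d * c z powr q" using cpos[of z] powr_add[of "c z" "q-1" 1] by simp
      finally show ?thesis using d0 by (simp add: add_increasing2)
    next
      case False
      then have "c z \<le> a z / d" using d0 by (simp add: field_simps)
      then have "c z powr (q-1) * a z \<le> (a z / d) powr (q-1) * a z"
        using cpos[of z] apos[of z] q by (intro mult_right_mono powr_mono2) auto
      also have "(a z / d) powr (q-1) = d powr (1-q) * a z powr (q-1)"
        using powr_minus[of d "q-1"] apos[of z] d0 by (simp add: powr_divide field_simps)
      also have "\<dots> * a z = d powr (1-q) * a z powr q"
        using apos[of z] powr_add[of "a z" "q-1" 1] by simp
      finally show ?thesis using d0 by (simp add: add_increasing)
    qed
    finally have "c z powr (q-1) * (norm (deriv F z))\<^sup>2 \<le> (d * c z powr q + d powr (1-q) * a z powr q) * X"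
      using X by (simp add: mult_right_mono)
    then have "q\<^sup>2 * (c z powr (q-1) * (norm (deriv F z))\<^sup>2) \<le> q\<^sup>2 * ((d * c z powr q + d powr (1-q) * a z powr q) * X)"
      by (intro mult_left_mono) auto
    then have d3: "\<delta>3 z \<le> q\<^sup>2 * (d * c z powr q * X) + q\<^sup>2 * (d powr (1-q) * a z powr q * X)"
      using 3(2)[OF z] q by (simp add: power2_eq_square algebra_simps)
    show "0 \<le> A * \<delta>1 z + 1 / 2 * \<delta>2 z + (-1) * \<delta>3 z"
      using d1 d2 d3 by linarith
  qed
  have sub: "sphere 0 \<bar>r\<bar> \<subseteq> ball 0 R" using r by auto
  note cont = continuous_on_subset[OF wirtinger_continuous(1)[OF 1(1)] sub]
    continuous_on_subset[OF wirtinger_continuous(1)[OF 2(1)] sub]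
    continuous_on_subset[OF wirtinger_continuous(1)[OF 3(1)] sub]
  have "continuous_on (sphere 0 \<bar>r\<bar>) a"
    unfolding a_def by (intro continuous_intros continuous_on_subset[OF holomorphic_on_imp_continuous_on[OF hol(1)] sub])
  then have ca: "continuous_on (sphere 0 \<bar>r\<bar>) (\<lambda>z. a z powr q)"
    by (rule continuous_on_powr[OF _ continuous_on_const]) (metis apos less_irrefl)
  have "cmean r ?D = A * cmean r (?e a) + 1 / 2 * cmean r (?e c) - cmean r (\<lambda>z. c z powr q)"
    by (subst cmean_lincomb[OF cont]) simp
  moreover have "cmean r (?e a) \<le> cmean r (\<lambda>z. a z powr q)"
    using r by (intro cmean_mono cont ca) (auto simp: a_def intro!: exp_mult_le)
  then have "A * cmean r (?e a) \<le> A * cmean r (\<lambda>z. a z powr q)"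
    using A0 by (intro mult_left_mono) auto
  moreover have "cmean r (?e c) \<le> cmean r (\<lambda>z. c z powr q)"
    using r by (intro cmean_mono cont) (auto simp: c_def intro!: exp_mult_le)
  moreover have "0 \<le> A * ?e a 0 + 1 / 2 * ?e c 0" using A0 by simp
  \<comment> \<open>\<open>F 0 = 0\<close> gives \<open>c 0 = 1\<close>.\<close>
  then have "- 1 \<le> ?D 0" using F0 by (simp add: c_def)
  \<comment> \<open>The mean of \<open>?e c\<close> is at most that of \<open>c powr q\<close>; half
    of it is absorbed into the left side, which doubles the remaining constants.\<close>
  ultimately have "cmean r (\<lambda>z. c z powr q) \<le> 2 * A * cmean r (\<lambda>z. a z powr q) + 2"
    using \<open>?D 0 \<le> cmean r ?D\<close> by linarith
  then show ?thesis by (simp add: A_def a_def c_def)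
qed

end

text \<open>Passes from the regularized integrand \<open>(|f|^2 + 1) powr q\<close> back to
  \<open>|f| powr p\<close> with \<open>p = 2 * q\<close>.\<close>

lemma one_plus_square_powr_le:
  fixes x q :: real
  assumes "0 \<le> x" "0 < q"
  shows "(x\<^sup>2 + 1) powr q \<le> 2 powr q * (x powr (2*q) + 1)"
proof -
  have 1: "(x\<^sup>2) powr q = x powr (2*q)" using assms by (simp add: powr_powr flip: powr_numeral)
  have "(x\<^sup>2 + 1) powr q \<le> (2 * max (x\<^sup>2) 1) powr q" using assms by (intro powr_mono2) auto
  also have "\<dots> = 2 powr q * max (x\<^sup>2) 1 powr q" by (simp add: powr_mult)
  also have "max (x\<^sup>2) 1 powr q \<le> (x\<^sup>2) powr q + 1" by (simp add: max_def)
  finally show ?thesis unfolding 1 by simp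
qed

lemma volterra_in_hardy_space:
  assumes p: "0 < p" and f: "f \<in> hardy_space p" and g: "g \<in> BMOA"
  shows "volterra g f \<in> hardy_space p"
proof -
  define q where "q = p / 2"
  have q: "0 < q" and pq: "p = 2 * q" using p by (auto simp: q_def)
  have holg: "g holomorphic_on unit_disk" using g by (simp add: BMOA_def hardy_space_def Hol_def)
  obtain K where holf: "f holomorphic_on unit_disk"
    and K: "\<And>r. r \<in> {0..<1} \<Longrightarrow> cmean r (\<lambda>z. norm (f z) powr p) \<le> K"
    using f unfolding hardy_space_iff[OF p] by blast
  note F = volterra_primitive[OF holf holg]
  obtain M where M: "\<And>R. 0 < R \<Longrightarrow> R < 1 \<Longrightarrow> \<exists>G. G holomorphic_on ball 0 R \<and>
      (\<forall>z\<in>ball 0 R. (norm (g z))\<^sup>2 \<le> Re (G z) \<and> Re (G z) \<le> (norm (g z))\<^sup>2 + M)"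
    using BMOA_harmonic_majorant[OF g] by metis
  define C where "C = (if q \<le> 1 then q * exp M + 1 / q
    else 2 * (q\<^sup>2 * (exp (- M) / (2 * q\<^sup>2)) powr (1-q) * exp M))"
  have C0: "0 \<le> C" using q by (auto simp: C_def intro!: add_nonneg_nonneg)
  \<comment> \<open>Both additive constants, \<open>(|f 0|^2 + 1) powr q\<close> and 2, are included
    so that one bound serves both ranges of \<open>q\<close>.\<close>
  define B where "B = C * (2 powr q * (K + 1)) + (((norm (f 0))\<^sup>2 + 1) powr q + 2)"
  have "cmean r (\<lambda>z. norm (volterra g f z) powr p) \<le> B" if r: "r \<in> {0..<1}" for r
  proof -
    \<comment> \<open>\<open>R\<close> depends on \<open>r\<close>, which is harmless since neither
      \<open>C\<close> nor \<open>B\<close> depends on \<open>R\<close>.\<close>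
    obtain R where R: "r < R" "R < 1" using r dense[of r 1] by auto
    then have R0: "0 < R" using r by auto
    obtain G where G: "G holomorphic_on ball 0 R"
      "\<And>z. z \<in> ball 0 R \<Longrightarrow> (norm (g z))\<^sup>2 \<le> Re (G z) \<and> Re (G z) \<le> (norm (g z))\<^sup>2 + M"
      using M[OF R0 R(2)] by blast
    have sub: "ball 0 R \<subseteq> unit_disk" using R by auto
    interpret volterra_pair R M f g "volterra g f" G
    proof
      show "deriv (volterra g f) z = f z * deriv g z" if "z \<in> ball 0 R" for z
        using F(2)[of z] that R by (intro DERIV_imp_deriv) auto
    qed (use G F(1) holomorphic_on_subset[OF _ sub] holf holg F(3) in auto)
    have cs: "continuous_on (sphere 0 \<bar>r\<bar>) f" "continuous_on (sphere 0 \<bar>r\<bar>) (volterra g f)"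
      using holomorphic_on_imp_continuous_on[OF holf] holomorphic_on_imp_continuous_on[OF F(3)] r
      by (auto elim!: continuous_on_subset)
    have cp: "continuous_on (sphere 0 \<bar>r\<bar>) (\<lambda>z. ((norm (h z))\<^sup>2 + 1) powr q)"
      if "continuous_on (sphere 0 \<bar>r\<bar>) h" for h :: "complex \<Rightarrow> complex"
      by (intro continuous_on_powr continuous_intros that) (metis add_nonneg_pos less_irrefl zero_le_power2 zero_less_one)
    note cf = continuous_on_norm_powr[OF cs(1) p]
    let ?m = "cmean r (\<lambda>z. ((norm (f z))\<^sup>2 + 1) powr q)"
    have "?m \<le> cmean r (\<lambda>z. 2 powr q * (norm (f z) powr p + 1))"
      using q by (intro cmean_mono cp cs continuous_intros cf) (simp add: pq one_plus_square_powr_le)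
    also have "\<dots> = 2 powr q * (cmean r (\<lambda>z. norm (f z) powr p) + 1)"
      by (simp add: cmean_cmult cmean_add[OF cf continuous_on_const])
    also have "\<dots> \<le> 2 powr q * (K + 1)" using K[OF r] by (intro mult_left_mono) auto
    finally have bound: "C * ?m \<le> C * (2 powr q * (K + 1))" using C0 by (intro mult_left_mono)
    have "cmean r (\<lambda>z. norm (volterra g f z) powr p) \<le> cmean r (\<lambda>z. ((norm (volterra g f z))\<^sup>2 + 1) powr q)"
    proof (rule cmean_mono[OF continuous_on_norm_powr[OF cs(2) p] cp[OF cs(2)]])
      fix z
      have "norm (volterra g f z) powr p = ((norm (volterra g f z))\<^sup>2) powr q"
        by (simp add: pq powr_powr flip: powr_numeral)
      also have "\<dots> \<le> ((norm (volterra g f z))\<^sup>2 + 1) powr q" using q by (intro powr_mono2) auto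
      finally show "norm (volterra g f z) powr p \<le> ((norm (volterra g f z))\<^sup>2 + 1) powr q" .
    qed
    also have "\<dots> \<le> C * ?m + (((norm (f 0))\<^sup>2 + 1) powr q + 2)"
    proof (cases "q \<le> 1")
      case True
      then show ?thesis using mean_bound_small_exponent[of q r] q r R by (simp add: C_def)
    next
      case False
      then have "cmean r (\<lambda>z. ((norm (volterra g f z))\<^sup>2 + 1) powr q) \<le> C * ?m + 2"
        using mean_bound_large_exponent[of q r] r R by (simp add: C_def)
      then show ?thesis by (smt (verit) powr_ge_zero)
    qed
    finally show ?thesis using bound by (simp add: B_def)
  qed
  then show ?thesis unfolding hardy_space_iff[OF p] using F(3) by blast
qed

section \<open>Means of derivatives\<close>

text \<open>The curve \<open>w * cis t\<close> is the circle of radius \<open>|w|\<close> started at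
  the argument of \<open>w\<close>; by periodicity the starting point does not affect the
  integral.\<close>

lemma cmean_rotate:
  fixes u :: "complex \<Rightarrow> real"
  assumes u: "continuous_on (sphere 0 (norm w)) u"
  shows "integral {0..2*pi} (\<lambda>t. u (w * cis t)) = 2 * pi * cmean (norm w) u"
proof -
  define s where "s = Arg2pi w"
  define k where "k = (\<lambda>t. u (of_real (norm w) * cis t))"
  have s: "0 \<le> s" "s < 2*pi" using Arg2pi[of w] by (auto simp: s_def)
  have "w = of_real (norm w) * cis s"
    using Arg2pi_eq[of w] by (simp add: s_def cis_conv_exp)
  then have w: "w * cis t = of_real (norm w) * cis (t + s)" for t
    by (metis cis_mult mult.assoc add.commute)
  have int: "k integrable_on {a..b}" for a b
    unfolding k_def by (rule circle_integrable) (use u in simp)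
  have per: "k (t + 2*pi) = k t" for t
    by (simp add: k_def flip: cis_mult)
  have shift: "integral {a..b} (\<lambda>t. k (t + c)) = integral {a+c..b+c} k" for a b c
    using integral_shift_real_ivl[of "a+c" c "b+c" k] by simp
  have "integral {0..2*pi} (\<lambda>t. u (w * cis t)) = integral {s..2*pi+s} k"
    using shift[of 0 "2*pi" s] by (simp add: k_def w)
  also have "\<dots> = integral {s..2*pi} k + integral {2*pi..2*pi+s} k"
    using Henstock_Kurzweil_Integration.integral_combine[of s "2*pi" "2*pi+s" k] s int by simp
  also have "integral {2*pi..2*pi+s} k = integral {0..s} k"
    using shift[of 0 s "2*pi"] by (simp add: per add.commute)
  also have "integral {s..2*pi} k + integral {0..s} k = integral {0..2*pi} k"
    using Henstock_Kurzweil_Integration.integral_combine[of 0 s "2*pi" k] s int by simp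
  finally show ?thesis by (simp add: cmean_def k_def)
qed

text \<open>A convex function lies above its tangents. Convexity is applied on the open half line,
  so \<open>x = 0\<close> is treated by hand.\<close>

lemma powr_tangent_le:
  fixes x y p :: real
  assumes "1 \<le> p" "0 \<le> x" "0 < y"
  shows "y powr p + p * y powr (p-1) * (x - y) \<le> x powr p"
proof (cases "x = 0")
  case True
  have "y powr p = y powr (p-1) * y" using assms powr_add[of y "p-1" 1] by simp
  then have "y powr p + p * y powr (p-1) * (x - y) = (1 - p) * y powr p"
    using True by (simp add: algebra_simps)
  also have "\<dots> \<le> 0" using assms by (intro mult_nonpos_nonneg) auto
  finally show ?thesis using True by simp
next
  case False
  have "((\<lambda>x. x powr p) has_real_derivative p * y powr (p-1)) (at y within {0<..})"
    using assms by (intro DERIV_subset[OF has_real_derivative_powr]) auto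
  from convex_on_imp_above_tangent[OF powr_convex[OF assms(1)] _ _ _ this, of x]
  show ?thesis using assms False by (simp add: interior_open)
qed

text \<open>Jensen's inequality: the tangent inequality at the mean \<open>y\<close> of
  \<open>h\<close> is integrated, and its linear term integrates to 0.\<close>

lemma integral_mean_powr_le:
  fixes h :: "real \<Rightarrow> real"
  assumes p: "1 \<le> p" and h: "continuous_on {0..2*pi} h" and h0: "\<And>t. 0 \<le> h t"
  shows "(integral {0..2*pi} h / (2*pi)) powr p \<le> integral {0..2*pi} (\<lambda>t. h t powr p) / (2*pi)"
proof -
  define y where "y = integral {0..2*pi} h / (2*pi)"
  have ih: "h integrable_on {0..2*pi}" using h by (rule integrable_continuous_real)
  have ihp: "(\<lambda>t. h t powr p) integrable_on {0..2*pi}"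
    using p h0 by (intro integrable_continuous_real continuous_on_powr' h continuous_on_const) auto
  have "0 \<le> y" unfolding y_def using h0 ih by (intro divide_nonneg_nonneg integral_nonneg) auto
  show ?thesis
  proof (cases "y = 0")
    case True
    have "0 \<le> integral {0..2*pi} (\<lambda>t. h t powr p)" by (intro integral_nonneg ihp) auto
    then show ?thesis using True by (simp add: y_def)
  next
    case False
    with \<open>0 \<le> y\<close> have y: "0 < y" by simp
    let ?l = "\<lambda>t. (y powr p - p * y powr (p-1) * y) + p * y powr (p-1) * h t"
    have "integral {0..2*pi} ?l \<le> integral {0..2*pi} (\<lambda>t. h t powr p)"
    proof (rule integral_le)
      show "?l integrable_on {0..2*pi}" using h by (intro integrable_continuous_real continuous_intros)
      show "?l t \<le> h t powr p" for t using powr_tangent_le[OF p h0 y, of t] by (simp add: algebra_simps)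
    qed (rule ihp)
    moreover have "integral {0..2*pi} ?l = 2*pi * (y powr p - p * y powr (p-1) * y) + p * y powr (p-1) * integral {0..2*pi} h"
      using ih by (subst integral_add) (auto intro: integrable_on_mult_right)
    moreover have "integral {0..2*pi} h = 2*pi*y" by (simp add: y_def)
    ultimately have "2*pi * y powr p \<le> integral {0..2*pi} (\<lambda>t. h t powr p)" by (simp add: algebra_simps)
    then show ?thesis unfolding y_def[symmetric] by (simp add: field_simps)
  qed
qed

text \<open>Cauchy's formula for the derivative, estimated by a mean rather than a maximum so that
  Jensen's inequality can follow.\<close>

lemma norm_deriv_le_circle_mean:
  assumes F: "F holomorphic_on S" "open S" and S: "cball z d \<subseteq> S" and d: "0 < d"
  shows "norm (deriv F z) \<le> integral {0..2*pi} (\<lambda>s. norm (F (z + of_real d * cis s))) / (2*pi) / d"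
proof -
  have cF: "continuous_on (cball z d) F"
    by (rule continuous_on_subset[OF holomorphic_on_imp_continuous_on[OF F(1)] S])
  have hF: "F holomorphic_on ball z d"
    by (rule holomorphic_on_subset[OF F(1)]) (use S ball_subset_cball in blast)
  have zin: "z \<in> ball z d" using d by simp
  let ?h = "\<lambda>u. F u / (u - z)\<^sup>2"
  let ?I = "integral {0..2*pi} (\<lambda>s. norm (F (z + of_real d * cis s)) / d)"
  have cs: "continuous_on {0..2*pi} (\<lambda>s. F (z + of_real d * cis s))"
    by (rule continuous_on_compose2[OF cF]) (use d in \<open>auto intro!: continuous_intros simp: dist_norm norm_mult\<close>)
  have dF: "deriv F z = 1 / (2 * of_real pi * \<i>) * contour_integral (circlepath z d) ?h"
    by (rule DERIV_imp_deriv[OF Cauchy_derivative_integral_circlepath(2)[OF cF hF zin]])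
  have ci: "contour_integral (circlepath z d) ?h
      = integral {0..2*pi} (\<lambda>s. ?h (z + of_real d * cis s) * of_real d * \<i> * cis s)"
    unfolding circlepath_def by (rule contour_integral_part_circlepath_eq) simp
  have "norm (integral {0..2*pi} (\<lambda>s. ?h (z + of_real d * cis s) * of_real d * \<i> * cis s)) \<le> ?I"
  proof (rule integral_norm_bound_integral)
    show "(\<lambda>s. ?h (z + of_real d * cis s) * of_real d * \<i> * cis s) integrable_on {0..2*pi}"
      using d cs by (intro integrable_continuous_real continuous_intros) auto
    show "(\<lambda>s. norm (F (z + of_real d * cis s)) / d) integrable_on {0..2*pi}"
      using d cs by (intro integrable_continuous_real continuous_intros) auto
    show "norm (?h (z + of_real d * cis s) * of_real d * \<i> * cis s) \<le> norm (F (z + of_real d * cis s)) / d" for s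
      using d by (simp add: norm_mult norm_divide norm_power power2_eq_square)
  qed
  then have "norm (contour_integral (circlepath z d) ?h) \<le> ?I" unfolding ci .
  then have "norm (contour_integral (circlepath z d) ?h) / (2*pi) \<le> ?I / (2*pi)"
    by (rule divide_right_mono) simp
  moreover have "norm (deriv F z) = norm (contour_integral (circlepath z d) ?h) / (2*pi)"
    unfolding dF by (simp add: norm_mult norm_divide)
  ultimately show ?thesis by (simp add: mult.commute)
qed

text \<open>Cauchy's estimate on circles of radius \<open>d = (1 - r) / 2\<close> and Jensen's
  inequality bound the integrand by means over \<open>s\<close>. After exchanging the integrals,
  each integral over \<open>t\<close> is a circle mean of \<open>|F|^p\<close> at radius
  \<open>|w s| < 1\<close>, hence controlled by \<open>K\<close>.\<close>

lemma cmean_deriv_powr_le: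
  assumes F: "F holomorphic_on unit_disk" and p: "1 \<le> p" and r: "0 \<le> r" "r < 1"
    and K: "\<And>\<rho>. \<rho> \<in> {0..<1} \<Longrightarrow> cmean \<rho> (\<lambda>z. norm (F z) powr p) \<le> K"
  shows "cmean r (\<lambda>z. norm (deriv F z) powr p) \<le> K * (2 / (1 - r)) powr p"
proof -
  define d where "d = (1 - r) / 2"
  have d: "0 < d" "r + d < 1" using r by (auto simp: d_def field_simps)
  have cF: "continuous_on unit_disk F" by (rule holomorphic_on_imp_continuous_on[OF F])
  have p0: "0 < p" using p by simp
  define w where "w = (\<lambda>s. of_real r + of_real d * cis s)"
  have wn: "norm (w s) < 1" for s
  proof -
    have "norm (w s) \<le> norm (complex_of_real r) + norm (of_real d * cis s)"
      unfolding w_def by (rule norm_triangle_ineq)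
    also have "\<dots> = r + d" using r d by (simp add: norm_mult)
    finally show ?thesis using d by simp
  qed
  define H where "H = (\<lambda>t s. norm (F (w s * cis t)) powr p)"
  have cH: "continuous_on T (\<lambda>y. H (fst y) (snd y))" for T
    unfolding H_def
    by (intro continuous_on_powr' continuous_intros continuous_on_compose2[OF cF])
       (use p0 wn in \<open>auto simp: w_def norm_mult intro!: continuous_intros\<close>)
  have cH1: "continuous_on T (\<lambda>s. H t s)" "continuous_on T (\<lambda>t. H t s)" for t s T
    by (rule continuous_on_compose2[OF cH[of UNIV], of _ "\<lambda>s. (t, s)", simplified] continuous_intros)+
       (rule continuous_on_compose2[OF cH[of UNIV], of _ "\<lambda>t. (t, s)", simplified], intro continuous_intros)
  have pt: "norm (deriv F (of_real r * cis t)) powr p \<le> integral {0..2*pi} (H t) / (2*pi) * (1/d) powr p" for t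
  proof -
    \<comment> \<open>Rotating first parametrizes the circle around \<open>r * cis t\<close> as
      \<open>w s * cis t\<close>, where \<open>t\<close> acts as a pure rotation; this is what
      \<open>cmean_rotate\<close> needs for fixed \<open>s\<close>.\<close>
    define Ft where "Ft = (\<lambda>z. F (cis t * z))"
    have Ft: "Ft holomorphic_on unit_disk"
      unfolding Ft_def
      by (rule holomorphic_on_compose_gen[of "\<lambda>z. cis t * z" unit_disk F unit_disk, unfolded o_def, OF _ F])
         (auto simp: norm_mult intro!: holomorphic_intros)
    have sub: "cball (of_real r) d \<subseteq> unit_disk"
    proof
      fix x :: complex assume "x \<in> cball (of_real r) d"
      then have "norm (x - of_real r) \<le> d" by (simp add: dist_norm norm_minus_commute)
      then have "norm x \<le> r + d"
        using norm_triangle_ineq2[of x "of_real r"] r by simp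
      then show "x \<in> unit_disk" using d by simp
    qed
    have "(F has_field_derivative deriv F (of_real r * cis t)) (at (cis t * of_real r))"
      using holomorphic_derivI[OF F open_ball, of "cis t * of_real r"] r by (simp add: norm_mult mult.commute)
    from DERIV_chain2[OF this DERIV_cmult[OF DERIV_ident]]
    have "deriv Ft (of_real r) = deriv F (of_real r * cis t) * cis t"
      unfolding Ft_def by (intro DERIV_imp_deriv) simp
    then have "norm (deriv F (of_real r * cis t)) = norm (deriv Ft (of_real r))" by (simp add: norm_mult)
    also have "\<dots> \<le> integral {0..2*pi} (\<lambda>s. norm (Ft (of_real r + of_real d * cis s))) / (2*pi) / d"
      by (rule norm_deriv_le_circle_mean[OF Ft open_ball sub d(1)])
    also have "\<dots> = integral {0..2*pi} (\<lambda>s. norm (F (w s * cis t))) / (2*pi) * (1/d)"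
      by (simp add: Ft_def w_def mult.commute)
    finally have "norm (deriv F (of_real r * cis t)) powr p
        \<le> (integral {0..2*pi} (\<lambda>s. norm (F (w s * cis t))) / (2*pi) * (1/d)) powr p"
      using p by (intro powr_mono2) auto
    also have "\<dots> = (integral {0..2*pi} (\<lambda>s. norm (F (w s * cis t))) / (2*pi)) powr p * (1/d) powr p"
      by (rule powr_mult)
    also have "\<dots> \<le> integral {0..2*pi} (H t) / (2*pi) * (1/d) powr p"
      unfolding H_def
      by (intro mult_right_mono integral_mean_powr_le[OF p] continuous_intros continuous_on_compose2[OF cF])
         (use wn in \<open>auto simp: w_def norm_mult intro!: continuous_intros\<close>)
    finally show ?thesis .
  qed
  have "continuous_on (cbox (0, 0) (2*pi, 2*pi)) (\<lambda>(t, s). H t s)"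
    unfolding case_prod_unfold by (rule cH)
  from integral_swap_continuous[OF this]
  have swap: "integral {0..2*pi} (\<lambda>t. integral {0..2*pi} (H t)) = integral {0..2*pi} (\<lambda>s. integral {0..2*pi} (\<lambda>t. H t s))"
    by simp
  have inner: "integral {0..2*pi} (\<lambda>t. H t s) \<le> 2 * pi * K" for s
  proof -
    have "integral {0..2*pi} (\<lambda>t. H t s) = 2 * pi * cmean (norm (w s)) (\<lambda>z. norm (F z) powr p)"
      unfolding H_def using wn[of s]
      by (intro cmean_rotate continuous_on_norm_powr p0 continuous_on_subset[OF cF]) auto
    also have "\<dots> \<le> 2 * pi * K" using wn[of s] by (intro mult_left_mono K) auto
    finally show ?thesis .
  qed
  have c2: "continuous_on {0..2*pi} (\<lambda>s. integral {0..2*pi} (\<lambda>t. H t s))"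
  proof -
    have "continuous_on ({0..2*pi} \<times> cbox 0 (2*pi)) (\<lambda>(s, t). H t s)"
      unfolding case_prod_unfold
      by (rule continuous_on_compose2[OF cH[of UNIV], of _ "\<lambda>y. (snd y, fst y)", simplified])
         (intro continuous_intros)
    from integral_continuous_on_param[OF this] show ?thesis by simp
  qed
  have c1: "continuous_on {0..2*pi} (\<lambda>t. integral {0..2*pi} (H t))"
    using integral_continuous_on_param[of "{0..2*pi}" 0 "2*pi" H] cH
    by (simp add: case_prod_unfold)
  have cd: "continuous_on {0..2*pi} (\<lambda>t. norm (deriv F (of_real r * cis t)) powr p)"
  proof -
    have "continuous_on unit_disk (deriv F)"
      using F by (intro holomorphic_on_imp_continuous_on holomorphic_deriv) auto
    then have "continuous_on {0..2*pi} (\<lambda>t. deriv F (of_real r * cis t))"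
      by (rule continuous_on_compose2) (use r in \<open>auto simp: norm_mult intro!: continuous_intros\<close>)
    then show ?thesis using p0 by (intro continuous_on_powr' continuous_intros) auto
  qed
  have "integral {0..2*pi} (\<lambda>t. norm (deriv F (of_real r * cis t)) powr p)
      \<le> integral {0..2*pi} (\<lambda>t. integral {0..2*pi} (H t) / (2*pi) * (1/d) powr p)"
    by (intro integral_le integrable_continuous_real cd continuous_intros c1 pt) auto
  also have "\<dots> = integral {0..2*pi} (\<lambda>s. integral {0..2*pi} (\<lambda>t. H t s)) / (2*pi) * (1/d) powr p"
    by (simp add: swap)
  also have "integral {0..2*pi} (\<lambda>s. integral {0..2*pi} (\<lambda>t. H t s)) \<le> integral {0..2*pi} (\<lambda>s. 2 * pi * K)"
    by (intro integral_le integrable_continuous_real c2 continuous_on_const inner)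
  finally have "integral {0..2*pi} (\<lambda>t. norm (deriv F (of_real r * cis t)) powr p)
      \<le> integral {0..2*pi} (\<lambda>s. 2 * pi * K) / (2*pi) * (1/d) powr p"
    by (simp add: divide_right_mono mult_right_mono)
  then have "cmean r (\<lambda>z. norm (deriv F z) powr p) \<le> K * (1/d) powr p"
    by (simp add: cmean_def field_simps)
  then show ?thesis by (simp add: d_def)
qed

section \<open>Lacunary series\<close>

text \<open>For \<open>r >= 1/2\<close> one has \<open>ln r >= -2 * (1 - r)\<close>, so
  \<open>n * ln r >= -4\<close>.\<close>

lemma power_ge_exp_minus_4:
  fixes r :: real
  assumes "1/2 \<le> r" "r < 1" "real n * (1 - r) \<le> 2"
  shows "exp (-4) \<le> r ^ n"
proof -
  have "(1 - r)\<^sup>2 \<le> (1 - r) * (1/2)"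
    unfolding power2_eq_square using assms by (intro mult_left_mono) auto
  then have "- 2 * (1 - r) \<le> ln r"
    using ln_one_minus_pos_lower_bound[of "1 - r"] assms by simp
  then have "real n * (- 2 * (1 - r)) \<le> real n * ln r" by (intro mult_left_mono) auto
  then have "-4 \<le> real n * ln r" using assms(3) by (simp add: algebra_simps)
  then have "exp (-4) \<le> exp (real n * ln r)" by simp
  also have "\<dots> = r ^ n" using assms by (simp add: exp_of_nat_mult)
  finally show ?thesis .
qed

text \<open>On \<open>|z| = r k\<close> term \<open>k\<close> of the derived series should dominate:
  by \<open>nr\<close> its size is at least \<open>c\<close> times \<open>(1/2)^k * n k\<close>,
  while \<open>growth\<close> bounds the earlier terms and \<open>decay\<close> the later ones by a
  quarter of that each, leaving \<open>c/2\<close>.\<close>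

locale lacunary =
  fixes r :: "nat \<Rightarrow> real" and n :: "nat \<Rightarrow> nat" and c :: real
  defines "c \<equiv> exp (-4)"
  assumes r: "\<And>k. 1/2 \<le> r k" "\<And>k. r k < 1"
    and nr: "\<And>k. 1 \<le> real (n k) * (1 - r k)" "\<And>k. real (n k) * (1 - r k) \<le> 2"
    and growth: "\<And>k. 2 * (1 + c/4) * real (n k) \<le> c/4 * real (n (Suc k))"
    and decay: "\<And>k m. n (Suc k) \<le> m \<Longrightarrow> real m * r k ^ (m - 1) \<le> c/4"
begin

lemma c: "0 < c" "c \<le> 1"
  by (simp_all add: c_def)

lemma n_pos: "0 < n k"
  using nr(1)[of k] by (cases "n k") auto

lemma n_mono: "mono n"
proof (rule mono_iff_le_Suc[THEN iffD2], rule allI)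
  fix k
  have "c/4 * real (n k) \<le> 2 * (1 + c/4) * real (n k)" using c by (intro mult_right_mono) auto
  also have "\<dots> \<le> c/4 * real (n (Suc k))" by (rule growth)
  finally show "n k \<le> n (Suc k)" using c by simp
qed

text \<open>\<open>growth\<close> is exactly the inductive step; its factor 2 compensates for
  passing from \<open>(1/2)^k\<close> to \<open>(1/2)^(k+1)\<close>.\<close>

lemma head_sum: "(\<Sum>j<k. (1/2) ^ j * real (n j)) \<le> c/4 * ((1/2) ^ k * real (n k))"
proof (induction k)
  case 0
  then show ?case using c by simp
next
  case (Suc k)
  have "(\<Sum>j<Suc k. (1/2) ^ j * real (n j)) \<le> c/4 * ((1/2) ^ k * real (n k)) + (1/2) ^ k * real (n k)"
    using Suc by simp
  also have "\<dots> = (1/2) ^ Suc k * (2 * (1 + c/4) * real (n k))" by (simp add: algebra_simps)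
  also have "\<dots> \<le> (1/2) ^ Suc k * (c/4 * real (n (Suc k)))" by (intro mult_left_mono growth) auto
  finally show ?case by (simp add: mult_ac)
qed

lemma BMOA_large_derivative:
  obtains g where "g \<in> BMOA"
    "\<And>k z. norm z = r k \<Longrightarrow> c/2 * ((1/2) ^ k * real (n k)) \<le> norm (deriv g z)"
proof -
  define f where "f = (\<lambda>k z. (1/2) ^ k * z ^ n k :: complex)"
  define f' where "f' = (\<lambda>k z. (1/2) ^ k * (of_nat (n k) * z ^ (n k - 1)) :: complex)"
  have f_le: "norm (f k z) \<le> (1/2) ^ k" if "norm z < 1" for k z
    using that by (simp add: f_def norm_mult norm_power norm_divide power_le_one power_divide divide_right_mono)
  have half: "summable (\<lambda>k. (1/2::real) ^ k)" "(\<Sum>k. (1/2::real) ^ k) = 2"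
    using summable_geometric[of "1/2::real"] suminf_geometric[of "1/2::real"] by simp_all
  \<comment> \<open>Weierstrass: the geometric majorant of the terms on the whole disk already
    permits termwise differentiation.\<close>
  have "\<exists>g g'. \<forall>z\<in>unit_disk. ((\<lambda>k. f k z) sums g z) \<and> ((\<lambda>k. f' k z) sums g' z) \<and> (g has_field_derivative g' z) (at z)"
  proof (rule series_and_derivative_comparison_complex[OF open_ball])
    show "(f k has_field_derivative f' k z) (at z)" for k z
      unfolding f_def f'_def by (auto intro!: derivative_eq_intros)
    fix z :: complex
    show "\<exists>d h. 0 < d \<and> summable h \<and> range h \<subseteq> (\<real>\<^sub>\<ge>\<^sub>0 :: complex set) \<and>
      (\<forall>\<^sub>F k in sequentially. \<forall>y\<in>ball z d \<inter> unit_disk. norm (f k y) \<le> norm (h k))"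
    proof (rule exI[of _ 1], rule exI[of _ "\<lambda>k. of_real ((1/2) ^ k)"], intro conjI)
      show "summable (\<lambda>k. of_real ((1/2) ^ k) :: complex)" using half(1) by (simp only: summable_of_real)
      show "range (\<lambda>k. of_real ((1/2) ^ k) :: complex) \<subseteq> \<real>\<^sub>\<ge>\<^sub>0" by (auto simp del: of_real_power)
      show "\<forall>\<^sub>F k in sequentially. \<forall>y\<in>ball z 1 \<inter> unit_disk. norm (f k y) \<le> norm (of_real ((1/2) ^ k) :: complex)"
        using f_le by (auto simp del: of_real_power intro!: always_eventually)
    qed simp
  qed
  then obtain g g' where "\<forall>z\<in>unit_disk. (\<lambda>k. f k z) sums g z \<and> (\<lambda>k. f' k z) sums g' z
      \<and> (g has_field_derivative g' z) (at z)" by blast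
  then have g: "\<And>z. norm z < 1 \<Longrightarrow> (\<lambda>k. f k z) sums g z"
    "\<And>z. norm z < 1 \<Longrightarrow> (\<lambda>k. f' k z) sums g' z"
    "\<And>z. norm z < 1 \<Longrightarrow> (g has_field_derivative g' z) (at z)" by simp_all
  show ?thesis
  proof (rule that)
    show "g \<in> BMOA"
    proof (rule bounded_in_BMOA)
      show "g holomorphic_on unit_disk"
        using g(3) by (subst holomorphic_on_open[OF open_ball]) (auto simp: ball_def)
      show "norm (g z) \<le> 2" if "norm z < 1" for z
      proof -
        have sm: "summable (\<lambda>k. norm (f k z))"
          by (rule summable_comparison_test'[OF half(1), of 0]) (use f_le[OF that] in auto)
        have "norm (g z) = norm (\<Sum>k. f k z)" using sums_unique[OF g(1)[OF that]] by simp
        also have "\<dots> \<le> (\<Sum>k. norm (f k z))" by (rule summable_norm[OF sm])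
        also have "\<dots> \<le> (\<Sum>k. (1/2) ^ k)" by (rule suminf_le[OF f_le[OF that] sm half(1)])
        finally show ?thesis using half(2) by simp
      qed
    qed
    fix k and z :: complex assume z: "norm z = r k"
    then have z1: "norm z < 1" using r by simp
    define X where "X = (1/2) ^ k * real (n k)"
    have nf': "norm (f' j z) = (1/2) ^ j * (real (n j) * r k ^ (n j - 1))" for j
      by (simp add: f'_def norm_mult norm_power norm_divide power_divide z)
    have sm: "summable (\<lambda>j. f' j z)" using g(2)[OF z1] by (simp add: sums_iff)
    have g': "g' z = (\<Sum>j. f' (j + Suc k) z) + ((\<Sum>j<k. f' j z) + f' k z)"
      using suminf_split_initial_segment[OF sm, of "Suc k"] sums_unique[OF g(2)[OF z1]] by simp
    have "norm (\<Sum>j<k. f' j z) \<le> (\<Sum>j<k. norm (f' j z))" by (rule norm_sum)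
    also have "\<dots> \<le> (\<Sum>j<k. (1/2) ^ j * real (n j))"
    proof (intro sum_mono)
      fix j
      have "real (n j) * r k ^ (n j - 1) \<le> real (n j) * 1"
        using r[of k] by (intro mult_left_mono power_le_one) auto
      then show "norm (f' j z) \<le> (1/2) ^ j * real (n j)"
        unfolding nf' by (intro mult_left_mono) auto
    qed
    also have "\<dots> \<le> c/4 * X" unfolding X_def by (rule head_sum)
    finally have 1: "norm (\<Sum>j<k. f' j z) \<le> c/4 * X" .
    have tail: "norm (f' (j + Suc k) z) \<le> (1/2) ^ Suc k * (c/4) * (1/2) ^ j" for j
    proof -
      \<comment> \<open>As \<open>n\<close> is monotone, \<open>decay\<close> at
        \<open>n (Suc k)\<close> covers all later exponents.\<close>
      have "n (Suc k) \<le> n (j + Suc k)" by (rule monoD[OF n_mono]) simp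
      from decay[OF this] have "norm (f' (j + Suc k) z) \<le> (1/2) ^ (j + Suc k) * (c/4)"
        unfolding nf' by (intro mult_left_mono) auto
      then show ?thesis by (simp add: power_add mult_ac)
    qed
    have smh: "summable (\<lambda>j. (1/2) ^ Suc k * (c/4) * (1/2) ^ j)" using half(1) by (rule summable_mult)
    have smt: "summable (\<lambda>j. norm (f' (j + Suc k) z))"
      by (rule summable_comparison_test'[OF smh, of 0]) (use tail in auto)
    have "norm (\<Sum>j. f' (j + Suc k) z) \<le> (\<Sum>j. norm (f' (j + Suc k) z))" by (rule summable_norm[OF smt])
    also have "\<dots> \<le> (\<Sum>j. (1/2) ^ Suc k * (c/4) * (1/2) ^ j)" by (rule suminf_le[OF tail smt smh])
    also have "\<dots> = (1/2) ^ k * (c/4)" by (subst suminf_mult[OF half(1)]) (simp add: half(2))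
    \<comment> \<open>Inserting \<open>n k >= 1\<close> brings the tail to the scale
      \<open>X\<close> of the main term.\<close>
    also have "\<dots> \<le> (1/2) ^ k * (c/4 * real (n k))"
      using n_pos[of k] c by (intro mult_left_mono) auto
    finally have 2: "norm (\<Sum>j. f' (j + Suc k) z) \<le> c/4 * X" by (simp add: X_def mult_ac)
    have "c \<le> r k ^ n k" unfolding c_def by (rule power_ge_exp_minus_4[OF r nr(2)])
    also have "\<dots> \<le> r k ^ (n k - 1)" using r[of k] by (intro power_decreasing) auto
    finally have "c * real (n k) \<le> r k ^ (n k - 1) * real (n k)" by (intro mult_right_mono) auto
    then have "(1/2) ^ k * (c * real (n k)) \<le> norm (f' k z)"
      unfolding nf' by (intro mult_left_mono) (auto simp: mult_ac)
    then have 3: "c * X \<le> norm (f' k z)" by (simp add: X_def mult_ac)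
    have "norm (f' k z) \<le> norm (g' z) + norm (\<Sum>j. f' (j + Suc k) z) + norm (\<Sum>j<k. f' j z)"
      using norm_triangle_ineq4[of "g' z" "(\<Sum>j. f' (j + Suc k) z) + (\<Sum>j<k. f' j z)"]
        norm_triangle_ineq[of "\<Sum>j. f' (j + Suc k) z" "\<Sum>j<k. f' j z"]
      unfolding g' by (simp add: algebra_simps)
    then have "c/2 * X \<le> norm (g' z)" using 1 2 3 by linarith
    then show "c/2 * ((1/2) ^ k * real (n k)) \<le> norm (deriv g z)"
      using DERIV_imp_deriv[OF g(3)[OF z1]] by (simp add: X_def)
  qed
qed

end

section \<open>Choice of radii and the converse inclusion\<close>

text \<open>A mean exceeding a bound for \<open>|f|^p\<close> on \<open>cball 0 \<rho>\<close> must
  have radius beyond \<open>\<rho>\<close>; then \<open>n\<close> is \<open>1 / (1 - r)\<close>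
  rounded up.\<close>

lemma large_mean_near_boundary:
  fixes f :: "complex \<Rightarrow> complex"
  assumes f: "f holomorphic_on unit_disk" and p: "0 < p" and unbounded: "f \<notin> hardy_space p"
  shows "\<exists>r n. 1/2 \<le> r \<and> r < 1 \<and> 1 \<le> real n * (1 - r) \<and> real n * (1 - r) \<le> 2 \<and> N \<le> n \<and>
    C < cmean r (\<lambda>z. norm (f z) powr p)"
proof -
  \<comment> \<open>The second entry turns \<open>\<rho> < r\<close> into
    \<open>1 / (1 - r) >= N + 1\<close>, hence \<open>N <= n\<close>.\<close>
  define \<rho> where "\<rho> = max (1/2) (1 - 1 / (real N + 1))"
  have \<rho>: "1/2 \<le> \<rho>" "\<rho> < 1" "1 - 1 / (real N + 1) \<le> \<rho>" by (auto simp: \<rho>_def)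
  have cf: "continuous_on unit_disk f" by (rule holomorphic_on_imp_continuous_on[OF f])
  have "compact (f ` cball 0 \<rho>)"
    using \<rho> by (intro compact_continuous_image continuous_on_subset[OF cf]) auto
  from compact_imp_bounded[OF this] obtain B where "\<forall>x\<in>f ` cball 0 \<rho>. norm x \<le> B"
    unfolding bounded_iff by blast
  then have B: "norm (f z) \<le> B" if "norm z \<le> \<rho>" for z using that by simp
  have "\<exists>r\<in>{0..<1}. max C (B powr p) < cmean r (\<lambda>z. norm (f z) powr p)"
    using unbounded f unfolding hardy_space_iff[OF p] by (meson not_le)
  then obtain r where r: "0 \<le> r" "r < 1" "C < cmean r (\<lambda>z. norm (f z) powr p)"
    "B powr p < cmean r (\<lambda>z. norm (f z) powr p)" by auto
  have "\<rho> < r"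
  proof (rule ccontr)
    assume "\<not> \<rho> < r"
    then have "cmean r (\<lambda>z. norm (f z) powr p) \<le> cmean r (\<lambda>_. B powr p)"
      using r B p by (intro cmean_mono continuous_on_norm_powr continuous_on_subset[OF cf] powr_mono2) auto
    then show False using r by simp
  qed
  define n where "n = nat \<lceil>1 / (1 - r)\<rceil>"
  have pos: "0 < 1 / (1 - r)" using r by simp
  have n1: "1 / (1 - r) \<le> real n" unfolding n_def by (rule real_nat_ceiling_ge)
  have n2: "real n \<le> 1 / (1 - r) + 1"
    using pos of_int_ceiling_le_add_one[of "1 / (1 - r)"] by (simp add: n_def)
  show ?thesis
  proof (intro exI[of _ r] exI[of _ n] conjI r(2,3))
    show "1/2 \<le> r" using \<rho> \<open>\<rho> < r\<close> by simp
    show "1 \<le> real n * (1 - r)" using n1 r by (simp add: field_simps)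
    have "real n * (1 - r) \<le> (1 / (1 - r) + 1) * (1 - r)" using n2 r by (intro mult_right_mono) auto
    also have "\<dots> \<le> 2" using r by (simp add: distrib_right)
    finally show "real n * (1 - r) \<le> 2" .
    have "1 - r \<le> 1 / (real N + 1)" using \<rho> \<open>\<rho> < r\<close> by simp
    then have "real N + 1 \<le> 1 / (1 - r)" using r by (simp add: field_simps)
    then show "N \<le> n" using n1 by simp
  qed
qed

text \<open>Dependent choice of pairs of radius and exponent: \<open>growth\<close> and
  \<open>decay\<close> relate consecutive pairs only and hold once the next exponent is large
  enough.\<close>

lemma exists_lacunary:
  fixes f :: "complex \<Rightarrow> complex"
  assumes f: "f holomorphic_on unit_disk" and p: "0 < p" and unbounded: "f \<notin> hardy_space p"
  obtains r n where "lacunary r n" "\<And>k. C k < cmean (r k) (\<lambda>z. norm (f z) powr p)"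
proof -
  define c :: real where "c = exp (-4)"
  have c: "0 < c" by (simp add: c_def)
  let ?P = "\<lambda>k (r, n). 1/2 \<le> r \<and> r < 1 \<and> 1 \<le> real n * (1 - r) \<and> real n * (1 - r) \<le> 2
    \<and> C k < cmean r (\<lambda>z. norm (f z) powr p)"
  let ?Q = "\<lambda>k (r, n) (r', n'). 2 * (1 + c/4) * real n \<le> c/4 * real n'
    \<and> (\<forall>m\<ge>n'. real m * r ^ (m - 1) \<le> c/4)"
  have "\<exists>x. \<forall>k. ?P k (x k) \<and> ?Q k (x k) (x (Suc k))"
  proof (rule dependent_nat_choice)
    show "\<exists>x. ?P 0 x" using large_mean_near_boundary[OF assms, of 0 "C 0"] by fastforce
    fix x k assume "?P k x"
    then obtain r n where x: "x = (r, n)" and r: "1/2 \<le> r" "r < 1" by (cases x) auto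
    have "(\<lambda>m. real m * r ^ m) \<longlonglongrightarrow> 0"
      using powser_times_n_limit_0[of r] r by simp
    \<comment> \<open>The factor \<open>r\<close> on the right pays for the exponent
      \<open>m - 1\<close> in \<open>decay\<close>.\<close>
    then have "eventually (\<lambda>m. real m * r ^ m < r * (c/4)) sequentially"
      using r c by (intro order_tendstoD) auto
    then obtain M where M: "\<And>m. M \<le> m \<Longrightarrow> real m * r ^ m < r * (c/4)"
      by (auto simp: eventually_sequentially)
    \<comment> \<open>Pushes the next exponent past both thresholds: \<open>M\<close> for
      \<open>decay\<close>, the quotient for \<open>growth\<close>.\<close>
    define N where "N = max M (nat \<lceil>2 * (1 + c/4) * real n / (c/4)\<rceil>)"
    have N: "2 * (1 + c/4) * real n / (c/4) \<le> real N"
      unfolding N_def by (rule order_trans[OF real_nat_ceiling_ge]) simp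
    obtain r' n' where y: "?P (Suc k) (r', n')" "N \<le> n'"
      using large_mean_near_boundary[OF assms, of N "C (Suc k)"] by fastforce
    have "2 * (1 + c/4) * real n / (c/4) \<le> real n'" using N y(2) by linarith
    then have 1: "2 * (1 + c/4) * real n \<le> c/4 * real n'"
      using c by (simp add: pos_divide_le_eq mult.commute)
    have 2: "real m * r ^ (m - 1) \<le> c/4" if "n' \<le> m" for m
    proof (cases m)
      case (Suc j)
      have "M \<le> m" using that y(2) by (simp add: N_def)
      then have "r * (real m * r ^ (m - 1)) < r * (c/4)" using M[of m] Suc by (simp add: mult_ac)
      then show ?thesis using r by simp
    qed (use c in simp)
    show "\<exists>y. ?P (Suc k) y \<and> ?Q k x y"
      using y(1) 1 2 by (intro exI[of _ "(r', n')"]) (simp add: x)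
  qed
  then obtain x where x: "\<And>k. ?P k (x k) \<and> ?Q k (x k) (x (Suc k))" by blast
  show ?thesis
  proof (rule that[of "fst \<circ> x" "snd \<circ> x"])
    show "lacunary (fst \<circ> x) (snd \<circ> x)"
      using x unfolding lacunary_def c_def case_prod_unfold o_def by blast
    show "C k < cmean ((fst \<circ> x) k) (\<lambda>z. norm (f z) powr p)" for k
      using x[of k] by (simp add: case_prod_unfold)
  qed
qed

text \<open>On \<open>|z| = r k\<close> the bound on \<open>deriv g\<close> gives
  \<open>|f| <= |F'| / X\<close> with \<open>X\<close> of order \<open>(1/2)^k / (1 - r k)\<close>,
  while the mean of \<open>|F'|^p\<close> is at most \<open>K * (2 / (1 - r k))^p\<close>. The
  factors \<open>1 - r k\<close> cancel, so the mean of \<open>|f|^p\<close> is at most a constant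
  times \<open>(2^k)^p\<close>, against the chosen growth beyond \<open>(4^k)^p\<close>.\<close>

lemma in_hardy_space_if_all_volterra:
  assumes p: "1 \<le> p" and f: "f holomorphic_on unit_disk"
    and T: "\<And>g. g \<in> BMOA \<Longrightarrow> volterra g f \<in> hardy_space p"
  shows "f \<in> hardy_space p"
proof (rule ccontr)
  assume "f \<notin> hardy_space p"
  have p0: "0 < p" using p by simp
  obtain r n where "lacunary r n" and big: "\<And>k. (4 ^ k) powr p < cmean (r k) (\<lambda>z. norm (f z) powr p)"
    using exists_lacunary[OF f p0 \<open>f \<notin> hardy_space p\<close>, of "\<lambda>k. (4 ^ k) powr p"] by blast
  interpret lacunary r n "exp (-4)" by fact simp
  define c :: real where "c = exp (-4)"
  have c: "0 < c" by (simp add: c_def)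
  obtain g where g: "g \<in> BMOA"
    "\<And>k z. norm z = r k \<Longrightarrow> c/2 * ((1/2) ^ k * real (n k)) \<le> norm (deriv g z)"
    using BMOA_large_derivative unfolding c_def by blast
  have holg: "g holomorphic_on unit_disk" using g by (simp add: BMOA_def hardy_space_def Hol_def)
  define F where "F = volterra g f"
  have F: "F holomorphic_on unit_disk" "\<And>z. norm z < 1 \<Longrightarrow> deriv F z = f z * deriv g z"
    using volterra_primitive[OF f holg] by (auto simp: F_def intro: DERIV_imp_deriv)
  obtain K where K: "\<And>\<rho>. \<rho> \<in> {0..<1} \<Longrightarrow> cmean \<rho> (\<lambda>z. norm (F z) powr p) \<le> K"
    using T[OF g(1)] unfolding hardy_space_iff[OF p0] F_def by blast
  have bound: "2 ^ k \<le> K * (4 / c) powr p" for k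
  proof -
    define X where "X = c/2 * ((1/2) ^ k * real (n k))"
    have X: "0 < X" using c n_pos[of k] by (simp add: X_def)
    have rk: "0 \<le> r k" "r k < 1" using r[of k] by auto
    have sub: "sphere 0 \<bar>r k\<bar> \<subseteq> unit_disk" using rk by auto
    have cf: "continuous_on (sphere 0 \<bar>r k\<bar>) (\<lambda>z. norm (f z) powr p)"
      by (intro continuous_on_norm_powr p0 continuous_on_subset[OF holomorphic_on_imp_continuous_on[OF f] sub])
    have cF: "continuous_on (sphere 0 \<bar>r k\<bar>) (\<lambda>z. norm (deriv F z) powr p)"
      by (intro continuous_on_norm_powr p0 continuous_on_subset[OF holomorphic_on_imp_continuous_on sub]
          holomorphic_deriv F open_ball)
    have "(4 ^ k) powr p < cmean (r k) (\<lambda>z. norm (f z) powr p)" by (rule big)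
    also have "\<dots> \<le> cmean (r k) (\<lambda>z. (1/X) powr p * norm (deriv F z) powr p)"
    proof (intro cmean_mono cf continuous_on_mult_left cF)
      fix z :: complex assume z: "norm z = \<bar>r k\<bar>"
      have "norm (f z) * X \<le> norm (deriv F z)"
        using F(2)[of z] z rk mult_left_mono[OF g(2)[of z k], of "norm (f z)"]
        by (simp add: norm_mult X_def)
      then have "norm (f z) \<le> 1/X * norm (deriv F z)" using X by (simp add: field_simps)
      then have "norm (f z) powr p \<le> (1/X * norm (deriv F z)) powr p" using p0 by (intro powr_mono2) auto
      also have "\<dots> = (1/X) powr p * norm (deriv F z) powr p" by (rule powr_mult)
      finally show "norm (f z) powr p \<le> (1/X) powr p * norm (deriv F z) powr p" .
    qed
    also have "\<dots> = (1/X) powr p * cmean (r k) (\<lambda>z. norm (deriv F z) powr p)" by (rule cmean_cmult)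
    also have "\<dots> \<le> (1/X) powr p * (K * (2 / (1 - r k)) powr p)"
      by (intro mult_left_mono cmean_deriv_powr_le[OF F(1) p rk K]) auto
    also have "\<dots> = K * (1/X * (2 / (1 - r k))) powr p"
      by (subst powr_mult[of "1/X"]) (rule mult.left_commute)
    also have "1/X * (2 / (1 - r k)) = 4 / c * 2 ^ k / (real (n k) * (1 - r k))"
      by (simp add: X_def power_divide field_simps)
    finally have *: "(4 ^ k) powr p < K * (4 / c * 2 ^ k / (real (n k) * (1 - r k))) powr p" .
    have "0 \<le> K"
    proof -
      have "0 \<le> cmean 0 (\<lambda>z. norm (F z) powr p)" by (intro cmean_nonneg) auto
      also have "\<dots> \<le> K" by (rule K) simp
      finally show ?thesis .
    qed
    have "4 / c * 2 ^ k / (real (n k) * (1 - r k)) \<le> 4 / c * 2 ^ k"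
      using nr(1)[of k] c divide_left_mono[of 1 "real (n k) * (1 - r k)" "4 / c * 2 ^ k"] by simp
    then have "(4 / c * 2 ^ k / (real (n k) * (1 - r k))) powr p \<le> (4 / c * 2 ^ k) powr p"
      using p0 c rk by (intro powr_mono2) auto
    then have "(4 ^ k) powr p < K * (4 / c * 2 ^ k) powr p"
      using * mult_left_mono[OF _ \<open>0 \<le> K\<close>] by fastforce
    also have "(4 / c * 2 ^ k) powr p = (4 / c) powr p * (2 ^ k) powr p" by (rule powr_mult)
    finally have "(2 ^ k) powr p * (2 ^ k) powr p < K * (4 / c) powr p * (2 ^ k) powr p"
      by (simp add: mult.assoc flip: powr_mult power_mult_distrib)
    then have "(2 ^ k) powr p \<le> K * (4 / c) powr p" by simp
    \<comment> \<open>Lowers the exponent to 1, so that unboundedness of the powers of 2 finishes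
      the proof.\<close>
    moreover have "(2 ^ k) powr 1 \<le> (2 ^ k :: real) powr p" using p by (intro powr_mono) auto
    ultimately show ?thesis by simp
  qed
  obtain k where "K * (4 / c) powr p < 2 ^ k" using real_arch_pow[of 2] by auto
  with bound[of k] show False by simp
qed

theorem theorem2p3:
  fixes p :: real
  assumes "1 \<le> p"
  shows "hardy_space p = (\<Inter>g\<in>BMOA. optimal_domain g p)"
proof (intro equalityI subsetI INT_I)
  fix f g assume f: "f \<in> hardy_space p" and g: "g \<in> BMOA"
  have "f \<in> Hol" using f unfolding hardy_space_def by blast
  moreover have "volterra g f \<in> hardy_space p"
    using assms by (intro volterra_in_hardy_space[OF _ f g]) simp
  ultimately show "f \<in> optimal_domain g p" unfolding optimal_domain_def by blast
next
  fix f assume f: "f \<in> (\<Inter>g\<in>BMOA. optimal_domain g p)"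
  \<comment> \<open>The intersection has at least one member, and any member forces \<open>f\<close>
    to be holomorphic.\<close>
  have "(\<lambda>_. 0) \<in> BMOA" by (rule bounded_in_BMOA[of _ 0]) simp_all
  with f have "f \<in> Hol" unfolding optimal_domain_def by blast
  then have "f holomorphic_on unit_disk" unfolding Hol_def by blast
  then show "f \<in> hardy_space p"
  proof (rule in_hardy_space_if_all_volterra[OF assms])
    show "volterra g f \<in> hardy_space p" if "g \<in> BMOA" for g
      using f that unfolding optimal_domain_def by blast
  qed
qed

end
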